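(* Let $n\ge 2$, let $p:\mathbb R\to\mathbb R$ be a smooth function with $\lim_{|x|\to\infty} p(x)/|x|=\infty$, let $a=(a_1,\dots,a_n)\in\mathbb R^n$ with $a_n=1$, write $a=(b,1)$ with $b\in\mathbb R^{n-1}$, and let $P(x)=p(x)\,a$, i.e. $p_j=a_jp$ for $1\le j\le n$. Writing $t=(s,t_n)$ with $s\in\mathbb R^{n-1}$, $t_n\in\mathbb R$ (and similarly $t'=(s',t_n')$), the Szeg\"o kernel of $M_P$ satisfies \[ S_P\big((x,y,t),(x',y',t')\big) = \delta_0\big[(s-s') - b(t_n-t_n')\big]\; S_p\big((x,y,t_n),(x',y',t_n')\big), \] where $\delta_0$ is the Dirac delta at the origin of $\mathbb R^{n-1}$ and $S_p$ is the Szeg\"o kernel of the one-codimensional model $M_p=\{(z,w)\in\mathbb C\times\mathbb C:\operatorname{Im}w=p(x)\}$ (the case $n=1$ of the construction below).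
   Context: For smooth $p_1,\dots,p_n:\mathbb R\to\mathbb R$ and $P=(p_1,\dots,p_n)$, the model is $M_P=\{(z,w)\in\mathbb C\times\mathbb C^n:\operatorname{Im}w=P(x)\}$, with $z=x+iy$, $w=t+is'$ (here $t=\operatorname{Re} w\in\mathbb R^n$). Identify $M_P$ with $\mathbb C\times\mathbb R^n$ (coordinates $(x,y,t)$, Lebesgue measure) via $(z,t+iP(x))\leftrightarrow(x,y,t)$; the tangential Cauchy–Riemann operator becomes $\bar L=\frac{\partial}{\partial x}+i\big(\frac{\partial}{\partial y}-P'(x)\cdot\frac{\partial}{\partial t}\big)$. The Szeg\"o projection $S_P$ is the orthogonal projection of $L^2(\mathbb C\times\mathbb R^n)$ onto $L^2(\mathbb C\times\mathbb R^n)\cap\ker\bar L$, and the Szeg\"o kernel $S_P((x,y,t),(x',y',t'))$ is its distributional integral kernel. For $n=1$ with a single function $p$ this defines $M_p\subset\mathbb C^2$, $\bar L=\partial_x+i(\partial_y-p'(x)\partial_t)$ on $\mathbb R^3$, and $S_p$; explicitly $S_p((x,y,t),(x',y',t'))=\int_{\Sigma_p}\frac{1}{C^1_{\eta,r}}e^{2\pi\eta((x+x')+i(y-y'))}e^{-2\pi r(p(x)+p(x')-i(t-t'))}\,d\eta\,dr$ with $C^1_{\eta,r}=\int_{\mathbb R}e^{4\pi(\eta x-rp(x))}dx$ and $\Sigma_p=\{(\eta,r):C^1_{\eta,r}<\infty\}$. *)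

theory Defs
  imports "HOL-Analysis.Analysis"
begin

fun dirderiv :: "'a::real_normed_vector list \<Rightarrow> ('a \<Rightarrow> 'b::real_normed_vector) \<Rightarrow> 'a \<Rightarrow> 'b" where
  "dirderiv [] f = f"
| "dirderiv (v # vs) f = (\<lambda>x. frechet_derivative (dirderiv vs f) (at x) v)"

definition smooth_fun :: "('a::real_normed_vector \<Rightarrow> 'b::real_normed_vector) \<Rightarrow> bool" where
  "smooth_fun f \<longleftrightarrow> (\<forall>vs x. dirderiv vs f differentiable (at x))"

definition test_fun :: "('a::euclidean_space \<Rightarrow> complex) \<Rightarrow> bool" where
  "test_fun \<phi> \<longleftrightarrow> smooth_fun \<phi> \<and> bounded {X. \<phi> X \<noteq> 0}"

text \<open>Points of the model M_P are identified with (x, y, t) in R x R x V,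
  V = R^n (a Euclidean space); Lebesgue measure lborel.\<close>

definition Lbar :: "(real \<Rightarrow> 'v::euclidean_space) \<Rightarrow> (real \<times> real \<times> 'v \<Rightarrow> complex)
    \<Rightarrow> real \<times> real \<times> 'v \<Rightarrow> complex" where
  "Lbar P \<phi> X = (case X of (x, y, t) \<Rightarrow>
      frechet_derivative \<phi> (at X) (1, 0, 0)
      + \<i> * (frechet_derivative \<phi> (at X) (0, 1, 0)
             - frechet_derivative \<phi> (at X) (0, 0, frechet_derivative P (at x) 1)))"

definition L2_fun :: "('a::euclidean_space \<Rightarrow> complex) \<Rightarrow> bool" where
  "L2_fun f \<longleftrightarrow> f \<in> borel_measurable lborel \<and> integrable lborel (\<lambda>X. (cmod (f X))\<^sup>2)"

definition L2_inner :: "('a::euclidean_space \<Rightarrow> complex) \<Rightarrow> ('a \<Rightarrow> complex) \<Rightarrow> complex" where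
  "L2_inner f g = (\<integral>X. f X * cnj (g X) \<partial>lborel)"

text \<open>L^2 intersected with the distributional kernel of Lbar.  The formal transpose of
  Lbar is -Lbar (the coefficient P'(x) does not depend on t), so f solves Lbar f = 0 in the
  sense of distributions iff the integral of f * Lbar phi vanishes for all test functions phi.\<close>

definition CR_space :: "(real \<Rightarrow> 'v::euclidean_space) \<Rightarrow> (real \<times> real \<times> 'v \<Rightarrow> complex) set" where
  "CR_space P = {f. L2_fun f \<and> (\<forall>\<phi>. test_fun \<phi> \<longrightarrow> (\<integral>X. f X * Lbar P \<phi> X \<partial>lborel) = 0)}"

definition szego_proj :: "(real \<Rightarrow> 'v::euclidean_space) \<Rightarrow> (real \<times> real \<times> 'v \<Rightarrow> complex)
    \<Rightarrow> (real \<times> real \<times> 'v \<Rightarrow> complex)" where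
  "szego_proj P f = (SOME g. g \<in> CR_space P \<and> (\<forall>h\<in>CR_space P. L2_inner (\<lambda>X. f X - g X) h = 0))"

text \<open>Pairing of the Szego kernel with the test function psi (x) phi:
  the integral of S_P(X,X') phi(X') psi(X) over X and X', i.e. the integral of (S_P phi) psi.
  This is independent of the a.e. representative chosen by szego_proj.\<close>

definition szego_pair :: "(real \<Rightarrow> 'v::euclidean_space) \<Rightarrow> (real \<times> real \<times> 'v \<Rightarrow> complex)
    \<Rightarrow> (real \<times> real \<times> 'v \<Rightarrow> complex) \<Rightarrow> complex" where
  "szego_pair P \<phi> \<psi> = (\<integral>X. szego_proj P \<phi> X * \<psi> X \<partial>lborel)"

end

theory Submission
  imports Defs
begin

text \<open>The shear (u, x, y, \<tau>) \<mapsto> (x, y, u + \<tau> b, \<tau>) preserves Lebesgue measure and turns the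
  operator of the model P = p (b, 1) into the operator of p acting in (x, y, \<tau>), with u as a mere parameter.
  Hence the projection of a function 1_Q(u) f(x, y, \<tau>), Q bounded, is 1_Q(u) (S_p f)(x, y, \<tau>):
  the only point is that f - S_p f is orthogonal to the average over Q of any solution H on the big
  space, and that such an average solves the small equation, as one sees by testing H against
  products of a test function with smooth cutoffs of boxes in u.
  A sheared test function is an L2-limit of functions that are simple in u, and the projections are
  contractions, so the formula passes to the limit.\<close>

section \<open>Square-integrable functions and orthogonal projections\<close>

text \<open>\<open>szego_proj\<close> picks an arbitrary representative, so nothing is known about
  how the projection of the slice at u depends on u: the function sending (u, Y) to the value at Y
  of the projected slice need not be measurable, and it cannot simply be declared to be the
  projection of the sheared function. Freezing u at finitely many values removes this difficulty,
  because only finitely many representatives then occur; in the limit, only the scalars obtained by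
  pairing with slices of the second test function have to be measurable in u. As the projection is
  defined by choice, its existence has to be established first. It rests on the completeness of L2
  and on the square integrability of \<open>Lbar P phi\<close>, which makes the distributional
  equation a closed condition. The arguments use functions rather than classes modulo null sets, and
  the contraction estimate takes the place of uniqueness of the projection.\<close>

definition L2_sq :: "('a::euclidean_space \<Rightarrow> complex) \<Rightarrow> real" where
  "L2_sq f = (\<integral>X. (cmod (f X))\<^sup>2 \<partial>lborel)"

lemma L2_funI:
  "f \<in> borel_measurable lborel \<Longrightarrow> integrable lborel (\<lambda>X. (cmod (f X))\<^sup>2) \<Longrightarrow> L2_fun f"
  by (simp add: L2_fun_def)

lemma L2_fun_measurable: "L2_fun f \<Longrightarrow> f \<in> borel_measurable lborel"
  by (simp add: L2_fun_def)

lemma L2_fun_integrable: "L2_fun f \<Longrightarrow> integrable lborel (\<lambda>X. (cmod (f X))\<^sup>2)"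
  by (simp add: L2_fun_def)

lemma L2_sq_nonneg [simp]: "0 \<le> L2_sq f"
  by (simp add: L2_sq_def)

lemma L2_sq_cnj: "L2_sq (\<lambda>X. cnj (f X)) = L2_sq f"
  by (simp add: L2_sq_def)

lemma L2_fun_bound:
  assumes "f \<in> borel_measurable lborel" "integrable lborel (g :: _ \<Rightarrow> real)"
    and "\<And>X. (cmod (f X))\<^sup>2 \<le> g X"
  shows "L2_fun f"
  using assms(1)
proof (rule L2_funI)
  note [measurable] = assms(1)
  show "integrable lborel (\<lambda>X. (cmod (f X))\<^sup>2)"
    using assms(2)
  proof (rule Bochner_Integration.integrable_bound)
    show "AE X in lborel. norm ((cmod (f X))\<^sup>2) \<le> norm (g X)"
      using assms(3) by (auto intro!: AE_I2 order_trans[OF _ abs_ge_self])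
  qed measurable
qed

lemma L2_fun_add:
  assumes "L2_fun f" "L2_fun g"
  shows "L2_fun (\<lambda>X. f X + g X)"
proof (rule L2_fun_bound)
  show "(\<lambda>X. f X + g X) \<in> borel_measurable lborel"
    using assms[THEN L2_fun_measurable] by (rule borel_measurable_add)
  show "integrable lborel (\<lambda>X. 2 * (cmod (f X))\<^sup>2 + 2 * (cmod (g X))\<^sup>2)"
    by (intro Bochner_Integration.integrable_add integrable_mult_right L2_fun_integrable assms)
  fix X
  have "(cmod (f X + g X))\<^sup>2 \<le> (cmod (f X) + cmod (g X))\<^sup>2"
    by (intro power_mono norm_triangle_ineq norm_ge_zero)
  also have "\<dots> \<le> 2 * (cmod (f X))\<^sup>2 + 2 * (cmod (g X))\<^sup>2"
    using sum_squares_bound[of "cmod (f X)" "cmod (g X)"]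
    by (simp add: power2_sum)
  finally show "(cmod (f X + g X))\<^sup>2 \<le> 2 * (cmod (f X))\<^sup>2 + 2 * (cmod (g X))\<^sup>2" .
qed

lemma L2_fun_cmult: "L2_fun f \<Longrightarrow> L2_fun (\<lambda>X. c * f X)"
  by (auto simp: L2_fun_def norm_mult power_mult_distrib)

lemma L2_fun_cnj: "L2_fun f \<Longrightarrow> L2_fun (\<lambda>X. cnj (f X))"
  by (auto simp: L2_fun_def intro: borel_measurable_continuous_on[OF continuous_on_cnj[OF continuous_on_id]])

lemma L2_fun_diff: "L2_fun f \<Longrightarrow> L2_fun g \<Longrightarrow> L2_fun (\<lambda>X. f X - g X)"
  using L2_fun_add[of f "\<lambda>X. (-1) * g X"] L2_fun_cmult[of g "-1"] by simp

lemma L2_fun_zero: "L2_fun (\<lambda>_. 0)"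
  by (simp add: L2_fun_def)

lemma L2_fun_sum: "(\<And>i. i \<in> I \<Longrightarrow> L2_fun (f i)) \<Longrightarrow> L2_fun (\<lambda>X. \<Sum>i\<in>I. f i X)"
  by (induction I rule: infinite_finite_induct) (auto intro: L2_fun_add L2_fun_zero)

lemma L2_mult_integrable:
  assumes "L2_fun f" "L2_fun g"
  shows "integrable lborel (\<lambda>X. f X * g X)"
proof (rule Bochner_Integration.integrable_bound)
  show "integrable lborel (\<lambda>X. (cmod (f X))\<^sup>2 + (cmod (g X))\<^sup>2)"
    using assms by (auto dest: L2_fun_integrable)
  show "(\<lambda>X. f X * g X) \<in> borel_measurable lborel"
    using assms[THEN L2_fun_measurable] by (rule borel_measurable_times)
  show "AE X in lborel. norm (f X * g X) \<le> norm ((cmod (f X))\<^sup>2 + (cmod (g X))\<^sup>2)"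
  proof (rule AE_I2)
    fix X
    have "2 * (cmod (f X) * cmod (g X)) \<le> (cmod (f X))\<^sup>2 + (cmod (g X))\<^sup>2"
      using sum_squares_bound[of "cmod (f X)" "cmod (g X)"] by simp
    moreover have "0 \<le> cmod (f X) * cmod (g X)" by simp
    ultimately show "norm (f X * g X) \<le> norm ((cmod (f X))\<^sup>2 + (cmod (g X))\<^sup>2)"
      unfolding norm_mult real_norm_def by linarith
  qed
qed

lemma L2_inner_integrable:
  "L2_fun f \<Longrightarrow> L2_fun g \<Longrightarrow> integrable lborel (\<lambda>X. f X * cnj (g X))"
  by (intro L2_mult_integrable L2_fun_cnj)

lemma L2_inner_diff_left:
  "L2_fun f \<Longrightarrow> L2_fun g \<Longrightarrow> L2_fun h \<Longrightarrow> L2_inner (\<lambda>X. f X - g X) h = L2_inner f h - L2_inner g h"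
  by (simp add: L2_inner_def left_diff_distrib L2_inner_integrable)

lemma L2_inner_diff_eq_zero:
  assumes "\<And>X. f X = g X - h X" "L2_fun g" "L2_fun h" "L2_fun k"
    "L2_inner g k = 0" "L2_inner h k = 0"
  shows "L2_inner f k = 0"
  using L2_inner_diff_left[of g h k] assms by (simp add: fun_eq_iff[symmetric] assms(1)[abs_def])

lemma L2_inner_self: "L2_inner f f = of_real (L2_sq f)"
  by (simp add: L2_inner_def L2_sq_def complex_norm_square[symmetric] del: of_real_power)

lemma nn_integral_L2_sq:
  "L2_fun f \<Longrightarrow> (\<integral>\<^sup>+X. ennreal ((cmod (f X))\<^sup>2) \<partial>lborel) = ennreal (L2_sq f)"
  unfolding L2_sq_def by (rule nn_integral_eq_integral) (auto dest: L2_fun_integrable)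

text \<open>The pairing is bilinear, without a conjugate, because the distributional equation and
  \<open>szego_pair\<close> are; the case of the inner product follows by conjugating the second
  function.\<close>

lemma L2_Cauchy_Schwarz:
  assumes "L2_fun f" "L2_fun g"
  shows "cmod (\<integral>X. f X * g X \<partial>lborel) \<le> sqrt (L2_sq f) * sqrt (L2_sq g)"
proof -
  note [measurable] = L2_fun_measurable[OF assms(1)] L2_fun_measurable[OF assms(2)]
  have "ennreal (cmod (\<integral>X. f X * g X \<partial>lborel)) \<le> (\<integral>\<^sup>+X. norm (f X * g X) \<partial>lborel)"
    by (rule integral_norm_bound_ennreal[OF L2_mult_integrable[OF assms]])
  then have "ennreal ((cmod (\<integral>X. f X * g X \<partial>lborel))\<^sup>2) \<le> (\<integral>\<^sup>+X. norm (f X * g X) \<partial>lborel)\<^sup>2"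
    by (simp add: ennreal_power[symmetric] power_mono)
  also have "\<dots> = (\<integral>\<^sup>+X. ennreal (cmod (f X)) * ennreal (cmod (g X)) \<partial>lborel)\<^sup>2"
    by (simp add: norm_mult ennreal_mult)
  also have "\<dots> \<le> (\<integral>\<^sup>+X. ennreal (cmod (f X)) ^ 2 \<partial>lborel) * (\<integral>\<^sup>+X. ennreal (cmod (g X)) ^ 2 \<partial>lborel)"
    by (rule Cauchy_Schwarz_nn_integral) auto
  also have "\<dots> = ennreal (L2_sq f * L2_sq g)"
    by (simp add: ennreal_power nn_integral_L2_sq assms ennreal_mult)
  finally have "(cmod (\<integral>X. f X * g X \<partial>lborel))\<^sup>2 \<le> L2_sq f * L2_sq g"
    by (simp add: ennreal_le_iff)
  then show ?thesis
    by (metis real_le_rsqrt real_sqrt_mult)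
qed

text \<open>Riesz-Fischer at a prescribed rate. Weighting the squared increments by 2^k leaves
  integrals of at most (1/4)^k, so their sum is finite almost everywhere; where it equals c, the
  increments are at most sqrt (c / 2^k) and \<open>f k X\<close> converges. Fatou's lemma in m then
  transfers the rate to the limit.\<close>

lemma L2_fast_Cauchy_complete:
  fixes f :: "nat \<Rightarrow> 'a::euclidean_space \<Rightarrow> complex"
  assumes L2: "\<And>k. L2_fun (f k)"
    and Cauchy: "\<And>k m. k \<le> m \<Longrightarrow> L2_sq (\<lambda>X. f k X - f m X) \<le> (1/8) ^ k"
  shows "\<exists>g. L2_fun g \<and> (\<forall>k. L2_sq (\<lambda>X. f k X - g X) \<le> (1/8) ^ k)"
proof -
  note [measurable] = L2_fun_measurable[OF L2]
  define d where "d k X = ennreal (2 ^ k * (cmod (f k X - f (Suc k) X))\<^sup>2)" for k X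
  have [measurable]: "d k \<in> borel_measurable lborel" for k
    unfolding d_def by measurable
  have "(\<integral>\<^sup>+X. (\<Sum>k. d k X) \<partial>lborel) = (\<Sum>k. \<integral>\<^sup>+X. d k X \<partial>lborel)"
    by (rule nn_integral_suminf) simp
  also have "\<dots> \<le> (\<Sum>k. ennreal ((1/4) ^ k))"
  proof (intro suminf_le allI)
    fix k
    have "(\<integral>\<^sup>+X. d k X \<partial>lborel) = ennreal (2 ^ k) * (\<integral>\<^sup>+X. ennreal ((cmod (f k X - f (Suc k) X))\<^sup>2) \<partial>lborel)"
      unfolding d_def by (simp add: ennreal_mult nn_integral_cmult)
    also have "\<dots> = ennreal (2 ^ k * L2_sq (\<lambda>X. f k X - f (Suc k) X))"
      by (subst nn_integral_L2_sq) (auto intro: L2_fun_diff L2 simp: ennreal_mult)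
    also have "\<dots> \<le> ennreal (2 ^ k * (1/8) ^ k)"
      by (intro ennreal_leI mult_left_mono Cauchy) auto
    also have "(2::real) ^ k * (1/8) ^ k = (1/4) ^ k"
      by (simp add: power_mult_distrib[symmetric])
    finally show "(\<integral>\<^sup>+X. d k X \<partial>lborel) \<le> ennreal ((1/4) ^ k)" .
  qed auto
  also have "\<dots> < top"
    by (subst suminf_ennreal2) (auto intro: summable_geometric)
  finally have "AE X in lborel. (\<Sum>k. d k X) \<noteq> top"
    by (intro nn_integral_PInf_AE[unfolded infinity_ennreal_def]) (auto simp: less_top)
  then have conv: "AE X in lborel. convergent (\<lambda>k. f k X)"
  proof eventually_elim
    fix X assume fin: "(\<Sum>k. d k X) \<noteq> top"
    obtain c where c: "(\<Sum>k. d k X) = ennreal c" "0 \<le> c"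
      using fin by (cases "\<Sum>k. d k X") auto
    have le: "cmod (f (Suc k) X - f k X) \<le> sqrt c * (sqrt (1/2)) ^ k" for k
    proof -
      have "d k X \<le> (\<Sum>k. d k X)"
        using sum_le_suminf[of "\<lambda>k. d k X" "{k}"] by simp
      then have "2 ^ k * (cmod (f k X - f (Suc k) X))\<^sup>2 \<le> c"
        using c by (simp add: d_def ennreal_le_iff)
      then have "(cmod (f (Suc k) X - f k X))\<^sup>2 \<le> c * (1/2) ^ k"
        by (simp add: norm_minus_commute field_simps)
      then have "cmod (f (Suc k) X - f k X) \<le> sqrt (c * (1/2) ^ k)"
        by (rule real_le_rsqrt)
      then show ?thesis
        by (simp add: real_sqrt_mult real_sqrt_power)
    qed
    have "summable (\<lambda>k. f (Suc k) X - f k X)"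
    proof (rule summable_comparison_test'[where N=0])
      show "summable (\<lambda>k. sqrt c * (sqrt (1/2)) ^ k)"
        by (intro summable_mult summable_geometric) auto
      show "norm (f (Suc k) X - f k X) \<le> sqrt c * (sqrt (1/2)) ^ k" if "k \<ge> 0" for k
        by (rule le)
    qed
    then have "convergent (\<lambda>k. f k X - f 0 X)"
      by (simp add: summable_iff_convergent sum_lessThan_telescope[of "\<lambda>k. f k X"])
    from convergent_add[OF this convergent_const[of "f 0 X"]]
    show "convergent (\<lambda>k. f k X)" by simp
  qed
  \<comment> \<open>On the null set of divergence \<open>lim\<close> has an unspecified value, which
    affects no integral.\<close>
  define g where "g X = lim (\<lambda>k. f k X)" for X
  have [measurable]: "g \<in> borel_measurable lborel"
    unfolding g_def by (rule borel_measurable_lim_metric) simp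
  have bound: "(\<integral>\<^sup>+X. ennreal ((cmod (f k X - g X))\<^sup>2) \<partial>lborel) \<le> ennreal ((1/8) ^ k)" for k
  proof -
    have "(\<integral>\<^sup>+X. ennreal ((cmod (f k X - g X))\<^sup>2) \<partial>lborel) =
       (\<integral>\<^sup>+X. liminf (\<lambda>m. ennreal ((cmod (f k X - f m X))\<^sup>2)) \<partial>lborel)"
      using conv
    proof (intro nn_integral_cong_AE, eventually_elim)
      fix X assume "convergent (\<lambda>k. f k X)"
      then have "(\<lambda>m. f m X) \<longlonglongrightarrow> g X"
        unfolding g_def by (simp add: convergent_LIMSEQ_iff)
      then have "(\<lambda>m. ennreal ((cmod (f k X - f m X))\<^sup>2)) \<longlonglongrightarrow> ennreal ((cmod (f k X - g X))\<^sup>2)"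
        by (intro tendsto_intros)
      then show "ennreal ((cmod (f k X - g X))\<^sup>2) = liminf (\<lambda>m. ennreal ((cmod (f k X - f m X))\<^sup>2))"
        by (intro lim_imp_Liminf[symmetric]) auto
    qed
    also have "\<dots> \<le> liminf (\<lambda>m. \<integral>\<^sup>+X. ennreal ((cmod (f k X - f m X))\<^sup>2) \<partial>lborel)"
      by (rule nn_integral_liminf) measurable
    also have "\<dots> = liminf (\<lambda>m. ennreal (L2_sq (\<lambda>X. f k X - f m X)))"
      by (subst nn_integral_L2_sq) (auto intro: L2_fun_diff L2)
    also have "\<dots> \<le> ennreal ((1/8) ^ k)"
    proof (rule Liminf_le)
      show "\<forall>\<^sub>F m in sequentially. ennreal (L2_sq (\<lambda>X. f k X - f m X)) \<le> ennreal ((1/8) ^ k)"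
        using eventually_ge_at_top[of k] by eventually_elim (intro ennreal_leI Cauchy)
    qed simp
    finally show ?thesis .
  qed
  have L2d: "L2_fun (\<lambda>X. f k X - g X)" for k
  proof (rule L2_funI)
    have "(\<integral>\<^sup>+X. ennreal ((cmod (f k X - g X))\<^sup>2) \<partial>lborel) < \<infinity>"
      using bound[of k] by (rule order_le_less_trans) auto
    then show "integrable lborel (\<lambda>X. (cmod (f k X - g X))\<^sup>2)"
      by (intro integrableI_bounded) auto
  qed measurable
  show ?thesis
  proof (intro exI[of _ g] conjI allI)
    show "L2_fun g"
      using L2_fun_diff[OF L2[of 0] L2d[of 0]] by simp
    show "L2_sq (\<lambda>X. f k X - g X) \<le> (1/8) ^ k" for k
      using bound[of k] by (simp add: nn_integral_L2_sq[OF L2d] ennreal_le_iff)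
  qed
qed

section \<open>Orthogonal projections onto subspaces of square-integrable functions\<close>

definition is_proj :: "('a::euclidean_space \<Rightarrow> complex) set \<Rightarrow> ('a \<Rightarrow> complex) \<Rightarrow> ('a \<Rightarrow> complex) \<Rightarrow> bool" where
  "is_proj C f g \<longleftrightarrow> g \<in> C \<and> (\<forall>h\<in>C. L2_inner (\<lambda>X. f X - g X) h = 0)"

text \<open>Closedness is split off: sums and contraction of projections hold in any linear
  subspace, and only existence calls for limits.\<close>

locale L2_subspace =
  fixes C :: "('a::euclidean_space \<Rightarrow> complex) set"
  assumes L2: "f \<in> C \<Longrightarrow> L2_fun f"
    and add: "f \<in> C \<Longrightarrow> g \<in> C \<Longrightarrow> (\<lambda>X. f X + g X) \<in> C"
    and cmult: "f \<in> C \<Longrightarrow> (\<lambda>X. c * f X) \<in> C"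
    and zero: "(\<lambda>X. 0) \<in> C"
begin

lemma diff: "f \<in> C \<Longrightarrow> g \<in> C \<Longrightarrow> (\<lambda>X. f X - g X) \<in> C"
  using add[of f "\<lambda>X. (-1) * g X"] cmult[of g "-1"] by simp

lemma sum: "(\<And>i. i \<in> I \<Longrightarrow> f i \<in> C) \<Longrightarrow> (\<lambda>X. \<Sum>i\<in>I. f i X) \<in> C"
  by (induction I rule: infinite_finite_induct) (auto intro: add zero)

lemma is_proj_sum:
  assumes "\<And>i. i \<in> I \<Longrightarrow> L2_fun (f i)" "\<And>i. i \<in> I \<Longrightarrow> is_proj C (f i) (g i)"
  shows "is_proj C (\<lambda>X. \<Sum>i\<in>I. f i X) (\<lambda>X. \<Sum>i\<in>I. g i X)"
  unfolding is_proj_def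
proof (intro conjI ballI)
  show "(\<lambda>X. \<Sum>i\<in>I. g i X) \<in> C"
    using assms by (intro sum) (auto simp: is_proj_def)
  fix h assume h: "h \<in> C"
  have "L2_inner (\<lambda>X. (\<Sum>i\<in>I. f i X) - (\<Sum>i\<in>I. g i X)) h = 
     (\<integral>X. (\<Sum>i\<in>I. (f i X - g i X) * cnj (h X)) \<partial>lborel)"
    by (simp add: L2_inner_def sum_subtractf[symmetric] sum_distrib_right)
  also have "\<dots> = (\<Sum>i\<in>I. L2_inner (\<lambda>X. f i X - g i X) h)"
    unfolding L2_inner_def
    using assms h by (intro Bochner_Integration.integral_sum L2_inner_integrable L2_fun_diff)
      (auto intro: L2 simp: is_proj_def)
  also have "\<dots> = 0"
    using assms h by (auto simp: is_proj_def)
  finally show "L2_inner (\<lambda>X. (\<Sum>i\<in>I. f i X) - (\<Sum>i\<in>I. g i X)) h = 0" .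
qed

text \<open>With e = g - g' in C and k = f - f', the difference k - e is orthogonal to e, so |e|^2 =
  <k, e>, which is at most |k| |e|. For f = f' this says that two projections of one function differ
  by norm zero, the form of uniqueness available for functions that are determined only almost
  everywhere.\<close>

lemma is_proj_contraction:
  assumes f: "L2_fun f" "is_proj C f g" and f': "L2_fun f'" "is_proj C f' g'"
  shows "L2_sq (\<lambda>X. g X - g' X) \<le> L2_sq (\<lambda>X. f X - f' X)"
proof -
  define e where "e X = g X - g' X" for X
  define k where "k X = f X - f' X" for X
  have gC: "g \<in> C" "g' \<in> C" using f f' by (auto simp: is_proj_def)
  then have eC: "e \<in> C" unfolding e_def by (rule diff)
  note L = L2[OF gC(1)] L2[OF gC(2)] L2[OF eC]
  have kL: "L2_fun k" unfolding k_def using f f' by (intro L2_fun_diff)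
  have "L2_inner (\<lambda>X. k X - e X) e = 0"
  proof (rule L2_inner_diff_eq_zero)
    show "k X - e X = (f X - g X) - (f' X - g' X)" for X by (simp add: k_def e_def)
    show "L2_inner (\<lambda>X. f X - g X) e = 0" "L2_inner (\<lambda>X. f' X - g' X) e = 0"
      using f f' eC by (auto simp: is_proj_def)
  qed (use f f' L in \<open>auto intro: L2_fun_diff\<close>)
  then have "L2_inner k e = of_real (L2_sq e)"
    using L2_inner_diff_left[OF kL L(3) L(3)] by (simp add: L2_inner_self)
  then have "L2_sq e = cmod (\<integral>X. k X * cnj (e X) \<partial>lborel)"
    by (simp add: L2_inner_def)
  also have "\<dots> \<le> sqrt (L2_sq k) * sqrt (L2_sq e)"
    using L2_Cauchy_Schwarz[OF kL L2_fun_cnj[OF L(3)]] by (simp only: L2_sq_cnj)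
  finally have *: "sqrt (L2_sq e) * sqrt (L2_sq e) \<le> sqrt (L2_sq k) * sqrt (L2_sq e)"
    by simp
  have "sqrt (L2_sq e) \<le> sqrt (L2_sq k)"
  proof (cases "L2_sq e = 0")
    case False
    then have "sqrt (L2_sq e) > 0" using L2_sq_nonneg[of e] by (simp add: order_less_le)
    with * show ?thesis by (rule mult_right_le_imp_le)
  qed simp
  then show ?thesis by (simp add: e_def[abs_def] k_def[abs_def])
qed

end

text \<open>Applied to a constant sequence, \<open>closed\<close> also gives stability under changes
  on null sets, which stands in for working with classes of functions.\<close>

locale L2_closed_subspace = L2_subspace +
  assumes closed: "(\<And>k. h k \<in> C) \<Longrightarrow> L2_fun g \<Longrightarrow> (\<lambda>k. L2_sq (\<lambda>X. h k X - g X)) \<longlonglongrightarrow> 0 \<Longrightarrow> g \<in> C"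
begin

text \<open>First variation of the squared distance. Moving g in the direction \<open>a * h\<close>,
  where a is the inner product that has to vanish, makes the linear term equal to -2 t |a|^2, and
  for small t > 0 the quadratic term cannot compensate it.\<close>

lemma minimizer_is_proj:
  assumes f: "L2_fun f" and g: "g \<in> C" 
    and min: "\<And>h. h \<in> C \<Longrightarrow> L2_sq (\<lambda>X. f X - g X) \<le> L2_sq (\<lambda>X. f X - h X)"
  shows "is_proj C f g"
  unfolding is_proj_def
proof (intro conjI ballI g)
  fix h assume h: "h \<in> C"
  define e where "e X = f X - g X" for X
  have eL: "L2_fun e" unfolding e_def by (intro L2_fun_diff f L2 g)
  note hL = L2[OF h]
  define a where "a = L2_inner e h"
  \<comment> \<open>compare the minimizer g with g + t a h for small real t\<close>
  have ineq: "2 * t * (cmod a)\<^sup>2 \<le> t\<^sup>2 * (cmod a)\<^sup>2 * L2_sq h" for t :: real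
  proof -
    have "L2_sq e \<le> L2_sq (\<lambda>X. f X - (g X + of_real t * a * h X))"
      unfolding e_def by (rule min) (intro add g cmult h)
    also have "(\<lambda>X. f X - (g X + of_real t * a * h X)) = (\<lambda>X. e X - of_real t * a * h X)"
      by (simp add: e_def fun_eq_iff)
    also have "L2_sq (\<lambda>X. e X - of_real t * a * h X) = 
       (\<integral>X. (cmod (e X))\<^sup>2 - 2 * t * Re (cnj a * (e X * cnj (h X))) + t\<^sup>2 * (cmod a)\<^sup>2 * (cmod (h X))\<^sup>2 \<partial>lborel)"
      unfolding L2_sq_def
    proof (rule Bochner_Integration.integral_cong[OF refl])
      fix X
      show "(cmod (e X - of_real t * a * h X))\<^sup>2 =
        (cmod (e X))\<^sup>2 - 2 * t * Re (cnj a * (e X * cnj (h X))) + t\<^sup>2 * (cmod a)\<^sup>2 * (cmod (h X))\<^sup>2"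
        unfolding cmod_power2 by (simp add: power2_eq_square algebra_simps)
    qed
    also have "\<dots> = L2_sq e - 2 * t * Re (cnj a * a) + t\<^sup>2 * (cmod a)\<^sup>2 * L2_sq h"
    proof -
      have i: "integrable lborel (\<lambda>X. cnj a * (e X * cnj (h X)))"
        using L2_inner_integrable[OF eL hL] by simp
      have "(\<integral>X. Re (cnj a * (e X * cnj (h X))) \<partial>lborel) = Re (\<integral>X. cnj a * (e X * cnj (h X)) \<partial>lborel)"
        using i by (rule integral_Re)
      also have "\<dots> = Re (cnj a * a)"
        by (simp add: a_def L2_inner_def)
      finally have "(\<integral>X. Re (cnj a * (e X * cnj (h X))) \<partial>lborel) = Re (cnj a * a)" .
      moreover have "integrable lborel (\<lambda>X. Re (cnj a * (e X * cnj (h X))))"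
        by (rule integrable_Re[OF i])
      ultimately show ?thesis
        using L2_fun_integrable[OF eL] L2_fun_integrable[OF hL]
        by (simp add: L2_sq_def del: times_complex.sel)
    qed
    also have "Re (cnj a * a) = (cmod a)\<^sup>2"
      unfolding cmod_power2 by (simp add: power2_eq_square)
    finally show ?thesis
      by simp
  qed
  have "a = 0"
  proof (rule ccontr)
    assume "a \<noteq> 0"
    then have pos: "0 < (cmod a)\<^sup>2" by simp
    have le: "2 * t \<le> t\<^sup>2 * L2_sq h" for t
      using ineq[of t] pos by (simp add: mult.commute[of _ "(cmod a)\<^sup>2"] mult.left_commute[of _ "(cmod a)\<^sup>2"])
    \<comment> \<open>The summand 1 avoids a division by zero when h vanishes almost everywhere, and
      it makes \<open>t * L2_sq h\<close> less than 1, which is incompatible with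
      \<open>2 * t \<le> t * (t * L2_sq h)\<close>.\<close>
    define t where "t = 1 / (L2_sq h + 1)"
    have t: "0 < t" "t * L2_sq h < 1"
      using add_nonneg_pos[OF L2_sq_nonneg[of h] zero_less_one] by (simp_all add: t_def)
    have "2 * t \<le> t * (t * L2_sq h)"
      using le[of t] by (simp add: power2_eq_square mult.assoc)
    also have "\<dots> \<le> t * 1"
      using t by (intro mult_left_mono) auto
    finally show False using t by simp
  qed
  then show "L2_inner (\<lambda>X. f X - g X) h = 0"
    by (simp add: a_def e_def[abs_def])
qed

text \<open>The parallelogram law for f - g and f - h. Since the midpoint of g and h lies in C
  again, it forces two nearly minimal points to be close to each other.\<close>

lemma parallelogram:
  assumes f: "L2_fun f" and g: "g \<in> C" "h \<in> C"
  shows "L2_sq (\<lambda>X. g X - h X) + 4 * L2_sq (\<lambda>X. f X - (1/2) * (g X + h X)) =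
    2 * L2_sq (\<lambda>X. f X - g X) + 2 * L2_sq (\<lambda>X. f X - h X)"
proof -
  note L = L2[OF g(1)] L2[OF g(2)]
  have "L2_fun (\<lambda>X. g X - h X)" "L2_fun (\<lambda>X. f X - (1/2) * (g X + h X))"
     "L2_fun (\<lambda>X. f X - g X)" "L2_fun (\<lambda>X. f X - h X)"
    by (intro L2_fun_diff L2_fun_cmult L2_fun_add f L)+
  note I = this[THEN L2_fun_integrable]
  have "L2_sq (\<lambda>X. g X - h X) + 4 * L2_sq (\<lambda>X. f X - (1/2) * (g X + h X)) = 
     (\<integral>X. (cmod (g X - h X))\<^sup>2 + 4 * (cmod (f X - (1/2) * (g X + h X)))\<^sup>2 \<partial>lborel)"
    unfolding L2_sq_def using I by simp
  also have "\<dots> = (\<integral>X. 2 * (cmod (f X - g X))\<^sup>2 + 2 * (cmod (f X - h X))\<^sup>2 \<partial>lborel)"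
    by (rule Bochner_Integration.integral_cong[OF refl])
      (unfold cmod_power2, simp add: power2_eq_square field_simps)
  also have "\<dots> = 2 * L2_sq (\<lambda>X. f X - g X) + 2 * L2_sq (\<lambda>X. f X - h X)"
    unfolding L2_sq_def using I by simp
  finally show ?thesis .
qed

text \<open>A minimizing sequence for the distance to C is Cauchy by the parallelogram law; its
  limit stays in C by closedness and attains the infimum.\<close>

theorem ex_is_proj:
  assumes f: "L2_fun f"
  shows "\<exists>g. is_proj C f g"
proof -
  define d where "d = (INF h\<in>C. L2_sq (\<lambda>X. f X - h X))"
  have bdd: "bdd_below ((\<lambda>h. L2_sq (\<lambda>X. f X - h X)) ` C)"
    by (rule bdd_belowI[of _ 0]) auto
  have d_le: "d \<le> L2_sq (\<lambda>X. f X - h X)" if "h \<in> C" for h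
    unfolding d_def by (rule cINF_lower[OF bdd that])
  \<comment> \<open>The excess is tuned to the rate of the completeness lemma: the parallelogram law
    doubles it for both indices, and (1/8)^k / 2 + (1/8)^m / 2 is at most (1/8)^k for k \<le>
    m.\<close>
  have "\<exists>h\<in>C. L2_sq (\<lambda>X. f X - h X) < d + (1/8) ^ k / 4" for k :: nat
  proof -
    have "d < d + (1/8) ^ k / 4" by simp
    then show ?thesis
      unfolding d_def using zero by (subst (asm) cINF_less_iff[OF _ bdd]) auto
  qed
  then obtain h where h: "\<And>k. h k \<in> C" "\<And>k::nat. L2_sq (\<lambda>X. f X - h k X) < d + (1/8) ^ k / 4"
    by metis
  have Cauchy: "L2_sq (\<lambda>X. h k X - h m X) \<le> (1/8) ^ k" if "k \<le> m" for k m
  proof -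
    have "(\<lambda>X. (1/2) * (h k X + h m X)) \<in> C" by (intro cmult add h)
    from d_le[OF this] have "L2_sq (\<lambda>X. h k X - h m X) + 4 * d \<le>
       2 * L2_sq (\<lambda>X. f X - h k X) + 2 * L2_sq (\<lambda>X. f X - h m X)"
      using parallelogram[OF f h(1) h(1), of k m] by simp
    moreover have "((1/8) ^ m :: real) \<le> (1/8) ^ k"
      using that by (intro power_decreasing) auto
    ultimately show ?thesis using h(2)[of k] h(2)[of m] by linarith
  qed
  obtain g where g: "L2_fun g" "\<And>k. L2_sq (\<lambda>X. h k X - g X) \<le> (1/8) ^ k"
    using L2_fast_Cauchy_complete[OF L2[OF h(1)] Cauchy] by blast
  have lim8: "(\<lambda>k. (1/8 :: real) ^ k) \<longlonglongrightarrow> 0"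
    by (rule LIMSEQ_power_zero) simp
  have lim0: "(\<lambda>k. L2_sq (\<lambda>X. h k X - g X)) \<longlonglongrightarrow> 0"
    by (rule tendsto_sandwich[OF _ _ tendsto_const lim8]) (auto intro!: always_eventually g)
  have gC: "g \<in> C"
    by (rule closed[OF h(1) g(1) lim0])
  have "L2_sq (\<lambda>X. f X - g X) \<le> d"
  proof (rule tendsto_lowerbound)
    \<comment> \<open>from the pointwise identity |f - g|^2 = |f - h|^2 + 2 Re ((f - g) cnj (h - g)) - |h - g|^2\<close>
    have eq: "L2_sq (\<lambda>X. f X - g X) \<le> L2_sq (\<lambda>X. f X - h k X) + 
       2 * (sqrt (L2_sq (\<lambda>X. f X - g X)) * sqrt (L2_sq (\<lambda>X. h k X - g X)))" for k
    proof -
      have L: "L2_fun (\<lambda>X. f X - g X)" "L2_fun (\<lambda>X. h k X - g X)" "L2_fun (\<lambda>X. f X - h k X)"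
        using f g h L2 by (auto intro: L2_fun_diff)
      note I = L[THEN L2_fun_integrable]
      note J = L2_inner_integrable[OF L(1,2)]
      have "L2_sq (\<lambda>X. f X - g X) \<le> (\<integral>X. (cmod (f X - h k X))\<^sup>2 + 2 * Re ((f X - g X) * cnj (h k X - g X)) \<partial>lborel)"
        unfolding L2_sq_def
      proof (rule integral_mono)
        show "integrable lborel (\<lambda>X. (cmod (f X - h k X))\<^sup>2 + 2 * Re ((f X - g X) * cnj (h k X - g X)))"
          using I integrable_Re[OF J] by (auto simp del: times_complex.sel)
        fix X
        have "(cmod (f X - h k X))\<^sup>2 + 2 * Re ((f X - g X) * cnj (h k X - g X)) - (cmod (f X - g X))\<^sup>2
           = (cmod (h k X - g X))\<^sup>2"
          unfolding cmod_power2 by (simp add: power2_eq_square algebra_simps)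
        then show "(cmod (f X - g X))\<^sup>2 \<le> (cmod (f X - h k X))\<^sup>2 + 2 * Re ((f X - g X) * cnj (h k X - g X))"
          using zero_le_power2[of "cmod (h k X - g X)"] by linarith
      qed (use I in auto)
      also have "\<dots> = L2_sq (\<lambda>X. f X - h k X) + 2 * Re (\<integral>X. (f X - g X) * cnj (h k X - g X) \<partial>lborel)"
        using I integrable_Re[OF J] integral_Re[OF J] by (simp add: L2_sq_def del: times_complex.sel)
      also have "Re (\<integral>X. (f X - g X) * cnj (h k X - g X) \<partial>lborel) \<le> cmod (\<integral>X. (f X - g X) * cnj (h k X - g X) \<partial>lborel)"
        by (rule complex_Re_le_cmod)
      also have "\<dots> \<le> sqrt (L2_sq (\<lambda>X. f X - g X)) * sqrt (L2_sq (\<lambda>X. h k X - g X))"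
        using L2_Cauchy_Schwarz[OF L(1) L2_fun_cnj[OF L(2)]] by (simp only: L2_sq_cnj)
      finally show ?thesis by simp
    qed
    show "\<forall>\<^sub>F k in sequentially. L2_sq (\<lambda>X. f X - g X) \<le> (d + (1/8) ^ k / 4) + 
       2 * (sqrt (L2_sq (\<lambda>X. f X - g X)) * sqrt (L2_sq (\<lambda>X. h k X - g X)))"
    proof (intro always_eventually allI)
      show "L2_sq (\<lambda>X. f X - g X) \<le> (d + (1/8) ^ k / 4) +
         2 * (sqrt (L2_sq (\<lambda>X. f X - g X)) * sqrt (L2_sq (\<lambda>X. h k X - g X)))" for k
        using eq[of k] h(2)[of k] by linarith
    qed
    have "(\<lambda>k. (d + (1/8) ^ k / 4) + 2 * (sqrt (L2_sq (\<lambda>X. f X - g X)) * sqrt (L2_sq (\<lambda>X. h k X - g X))))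
       \<longlonglongrightarrow> (d + 0 / 4) + 2 * (sqrt (L2_sq (\<lambda>X. f X - g X)) * sqrt 0)"
      by (intro tendsto_intros lim8 lim0) auto
    then show "(\<lambda>k. (d + (1/8) ^ k / 4) + 2 * (sqrt (L2_sq (\<lambda>X. f X - g X)) * sqrt (L2_sq (\<lambda>X. h k X - g X))))
       \<longlonglongrightarrow> d" by simp
  qed simp
  then have "is_proj C f g"
    by (intro minimizer_is_proj f gC) (metis d_le order_trans)
  then show ?thesis by blast
qed

end

section \<open>Smooth functions and test functions\<close>

text \<open>The head of the list is the direction differentiated last, so the derivative taken first
  is reached by splitting off the end of the list.\<close>

lemma dirderiv_append: "dirderiv (vs @ [v]) f = dirderiv vs (\<lambda>x. frechet_derivative f (at x) v)"
  by (induction vs) simp_all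

text \<open>Such a class contains all iterated derivatives of its members. Each closure property of
  smoothness thereby reduces to naming a class explicit enough to be stable under one derivative,
  with no induction over lists of directions.\<close>

lemma smooth_fun_coinduct:
  assumes "f \<in> C"
    and diff: "\<And>f x. f \<in> C \<Longrightarrow> f differentiable (at x)"
    and deriv: "\<And>f v. f \<in> C \<Longrightarrow> (\<lambda>x. frechet_derivative f (at x) v) \<in> C"
  shows "smooth_fun f"
proof -
  have "dirderiv vs f \<in> C" for vs
    by (induction vs) (auto intro: deriv assms(1))
  then show ?thesis
    unfolding smooth_fun_def using diff by blast
qed

lemma smooth_fun_differentiable: "smooth_fun f \<Longrightarrow> f differentiable (at x)"
  unfolding smooth_fun_def by (metis dirderiv.simps(1))

lemma smooth_fun_has_derivative:
  "smooth_fun f \<Longrightarrow> (f has_derivative frechet_derivative f (at x)) (at x)"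
  using smooth_fun_differentiable frechet_derivative_works by blast

lemma smooth_fun_deriv: "smooth_fun f \<Longrightarrow> smooth_fun (\<lambda>x. frechet_derivative f (at x) v)"
  unfolding smooth_fun_def dirderiv_append[symmetric] by blast

lemma smooth_fun_continuous: "smooth_fun f \<Longrightarrow> continuous_on S f"
  by (meson continuous_at_imp_continuous_on differentiable_imp_continuous_within smooth_fun_differentiable)

lemma frechet_derivative_eq: "(f has_derivative f') (at x) \<Longrightarrow> frechet_derivative f (at x) v = f' v"
  by (metis frechet_derivative_at)

lemma has_derivative_affine_compose:
  assumes "bounded_linear L" "(g has_derivative g') (at (L x + c))"
  shows "((\<lambda>x. g (L x + c)) has_derivative (\<lambda>v. g' (L v))) (at x)"
proof -
  have "((\<lambda>x. L x + c) has_derivative L) (at x)"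
    by (intro has_derivative_add_const bounded_linear_imp_has_derivative assms)
  from diff_chain_at[OF this assms(2)] show ?thesis by (simp add: o_def)
qed

text \<open>Differentiating in v replaces the outer function by its derivative in the fixed
  direction \<open>L v\<close> and keeps the inner map, so the class of these compositions is
  stable.\<close>

lemma smooth_fun_affine:
  assumes L: "bounded_linear L" and "smooth_fun f"
  shows "smooth_fun (\<lambda>x. f (L x + c))"
proof (rule smooth_fun_coinduct[where C="{\<lambda>x. g (L x + c) |g. smooth_fun g}"])
  note D = has_derivative_affine_compose[OF L smooth_fun_has_derivative]
  show "h differentiable (at x)" if "h \<in> {\<lambda>x. g (L x + c) |g. smooth_fun g}" for h x
    using that D unfolding differentiable_def by blast
  show "(\<lambda>x. frechet_derivative h (at x) v) \<in> {\<lambda>x. g (L x + c) |g. smooth_fun g}"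
    if h: "h \<in> {\<lambda>x. g (L x + c) |g. smooth_fun g}" for h v
  proof -
    obtain g where g: "h = (\<lambda>x. g (L x + c))" "smooth_fun g" using h by blast
    have "(\<lambda>x. frechet_derivative h (at x) v) = (\<lambda>x. frechet_derivative g (at (L x + c)) (L v))"
      unfolding g(1) by (intro ext frechet_derivative_eq D g)
    then show ?thesis using smooth_fun_deriv[OF g(2), of "L v"] by (auto intro!: exI[of _ "\<lambda>x. frechet_derivative g (at x) (L v)"])
  qed
qed (use assms in blast)

lemma smooth_fun_linear_compose:
  assumes L: "bounded_linear L" and "smooth_fun f"
  shows "smooth_fun (\<lambda>x. L (f x))"
proof (rule smooth_fun_coinduct[where C="{\<lambda>x. L (g x) |g. smooth_fun g}"])
  have D: "((\<lambda>x. L (g x)) has_derivative (\<lambda>v. L (frechet_derivative g (at x) v))) (at x)"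
    if "smooth_fun g" for g x
    using bounded_linear.has_derivative[OF L smooth_fun_has_derivative[OF that]] .
  show "h differentiable (at x)" if "h \<in> {\<lambda>x. L (g x) |g. smooth_fun g}" for h x
    using that D unfolding differentiable_def by blast
  show "(\<lambda>x. frechet_derivative h (at x) v) \<in> {\<lambda>x. L (g x) |g. smooth_fun g}"
    if h: "h \<in> {\<lambda>x. L (g x) |g. smooth_fun g}" for h v
  proof -
    obtain g where g: "h = (\<lambda>x. L (g x))" "smooth_fun g" using h by blast
    have "(\<lambda>x. frechet_derivative h (at x) v) = (\<lambda>x. L (frechet_derivative g (at x) v))"
      unfolding g(1) by (intro ext frechet_derivative_eq D g)
    then show ?thesis using smooth_fun_deriv[OF g(2), of v] by (auto intro!: exI[of _ "\<lambda>x. frechet_derivative g (at x) v"])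
  qed
qed (use assms in blast)

lemma smooth_fun_const: "smooth_fun (\<lambda>x. c)"
proof (rule smooth_fun_coinduct[where C="range (\<lambda>c x. c)"])
  show "(\<lambda>x. frechet_derivative f (at x) v) \<in> range (\<lambda>c x. c)"
    if "f \<in> range (\<lambda>c x. c)" for f :: "'a \<Rightarrow> 'b" and v
    using that frechet_derivative_eq[OF has_derivative_const] by fastforce
qed auto

text \<open>By the Leibniz rule the derivative of a product is a sum of two products, so products
  alone are not stable under differentiation, whereas their finite sums are.\<close>

inductive_set prod_span :: "('a::real_normed_vector \<Rightarrow> 'b::real_normed_algebra) set" where
  mult: "smooth_fun f \<Longrightarrow> smooth_fun g \<Longrightarrow> (\<lambda>x. f x * g x) \<in> prod_span"
| add: "f \<in> prod_span \<Longrightarrow> g \<in> prod_span \<Longrightarrow> (\<lambda>x. f x + g x) \<in> prod_span"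

lemma smooth_fun_mult:
  fixes f g :: "'a::real_normed_vector \<Rightarrow> 'b::real_normed_algebra"
  assumes "smooth_fun f" "smooth_fun g"
  shows "smooth_fun (\<lambda>x. f x * g x)"
proof (rule smooth_fun_coinduct[where C=prod_span])
  show diff: "h differentiable (at x)" if "h \<in> prod_span" for h :: "'a \<Rightarrow> 'b" and x
    using that by induction (auto intro: smooth_fun_differentiable differentiable_mult)
  show "(\<lambda>x. frechet_derivative h (at x) v) \<in> prod_span" if "h \<in> prod_span" for h :: "'a \<Rightarrow> 'b" and v
    using that
  proof induction
    case (mult f g)
    have "(\<lambda>x. frechet_derivative (\<lambda>x. f x * g x) (at x) v) =
      (\<lambda>x. f x * frechet_derivative g (at x) v + frechet_derivative f (at x) v * g x)"
      by (intro ext frechet_derivative_eq has_derivative_mult smooth_fun_has_derivative mult)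
    then show ?case
      by (auto intro!: prod_span.intros mult smooth_fun_deriv)
  next
    case (add f g)
    have "(\<lambda>x. frechet_derivative (\<lambda>x. f x + g x) (at x) v) =
      (\<lambda>x. frechet_derivative f (at x) v + frechet_derivative g (at x) v)"
      using add by (intro ext frechet_derivative_eq has_derivative_add)
        (auto simp: frechet_derivative_works[symmetric] diff)
    then show ?case
      using add by (auto intro!: prod_span.intros(2))
  qed
qed (use assms in \<open>auto intro: prod_span.intros\<close>)

lemma smooth_fun_prod:
  fixes f :: "'i \<Rightarrow> 'a::real_normed_vector \<Rightarrow> 'b::real_normed_field"
  shows "(\<And>i. i \<in> I \<Longrightarrow> smooth_fun (f i)) \<Longrightarrow> smooth_fun (\<lambda>x. \<Prod>i\<in>I. f i x)"
  by (induction I rule: infinite_finite_induct) (auto intro: smooth_fun_mult smooth_fun_const)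

section \<open>Flat functions and smooth cutoffs of boxes\<close>

text \<open>The real functions built from exp (-1/x) on x > 0 with polynomial factors in 1/x form a
  class that is closed under differentiation.\<close>

definition flat :: "real poly \<Rightarrow> real \<Rightarrow> real" where
  "flat q x = (if 0 < x then poly q (1 / x) * exp (- (1 / x)) else 0)"

lemma poly_times_exp_minus_tendsto_0:
  fixes q :: "real poly"
  shows "((\<lambda>y. poly q y * exp (- y)) \<longlongrightarrow> 0) at_top"
proof -
  have "((\<lambda>y. \<Sum>i\<le>degree q. coeff q i * (y ^ i / exp y)) \<longlongrightarrow> (\<Sum>i\<le>degree q. coeff q i * 0)) at_top"
    by (intro tendsto_intros tendsto_power_div_exp_0)
  then show ?thesis
    by (simp add: poly_altdef sum_distrib_right exp_minus divide_inverse mult.assoc)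
qed

text \<open>For x > 0 the derivative of q(1/x) exp(-1/x) is (1/x^2) (q - q')(1/x) exp(-1/x), whence
  the factor \<open>[:0, 0, 1:]\<close>. At 0 the right difference quotient is again a polynomial in
  1/h times exp(-1/h), which tends to 0.\<close>

lemma flat_has_derivative:
  "(flat q has_real_derivative flat ([:0, 0, 1:] * (q - pderiv q)) x) (at x)"
proof -
  consider "x > 0" | "x < 0" | "x = 0" by linarith
  then show ?thesis
  proof cases
    case 1
    have "((\<lambda>x. poly q (1 / x) * exp (- (1 / x))) has_real_derivative
        flat ([:0, 0, 1:] * (q - pderiv q)) x) (at x)"
      using 1 by (auto intro!: derivative_eq_intros DERIV_chain'[of "\<lambda>x. 1 / x", OF _ poly_DERIV]
          simp: flat_def field_simps power2_eq_square)
    then show ?thesis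
      by (rule DERIV_cong_ev[THEN iffD2, rotated 3])
        (use 1 in \<open>auto simp: flat_def eventually_nhds intro!: exI[of _ "{0<..}"]\<close>)
  next
    case 2
    have "((\<lambda>x. 0) has_real_derivative flat ([:0, 0, 1:] * (q - pderiv q)) x) (at x)"
      using 2 by (simp add: flat_def)
    then show ?thesis
      by (rule DERIV_cong_ev[THEN iffD2, rotated 3])
        (use 2 in \<open>auto simp: flat_def eventually_nhds intro!: exI[of _ "{..<0}"]\<close>)
  next
    case 3
    have "((\<lambda>h. flat q h / h) \<longlongrightarrow> 0) (at_right 0)"
    proof (rule Lim_transform_eventually)
      have "((\<lambda>h. poly ([:0, 1:] * q) (inverse h) * exp (- inverse h)) \<longlongrightarrow> 0) (at_right 0)"
        by (rule filterlim_compose[OF poly_times_exp_minus_tendsto_0 filterlim_inverse_at_top_right])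
      then show "((\<lambda>h. poly ([:0, 1:] * q) (1 / h) * exp (- (1 / h))) \<longlongrightarrow> 0) (at_right 0)"
        by (simp add: inverse_eq_divide)
      show "\<forall>\<^sub>F h in at_right 0. poly ([:0, 1:] * q) (1 / h) * exp (- (1 / h)) = flat q h / h"
        using eventually_at_right_less[of 0] by eventually_elim (simp add: flat_def)
    qed
    moreover have "((\<lambda>h. flat q h / h) \<longlongrightarrow> 0) (at_left 0)"
      by (rule tendsto_eventually) (auto simp: flat_def eventually_at_filter)
    ultimately have "((\<lambda>h. flat q h / h) \<longlongrightarrow> 0) (at 0)"
      using filterlim_split_at by blast
    then show ?thesis
      using 3 unfolding DERIV_def by (simp add: flat_def)
  qed
qed

lemma smooth_fun_flat: "smooth_fun (flat q)"
proof (rule smooth_fun_coinduct[where C="range flat"])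
  show "f differentiable (at x)" if "f \<in> range flat" for f x
    using that flat_has_derivative by (auto simp: real_differentiable_def)
  show "(\<lambda>x. frechet_derivative f (at x) v) \<in> range flat" if f: "f \<in> range flat" for f v
  proof -
    obtain q where q: "f = flat q" using f by blast
    have "frechet_derivative f (at x) v = flat (smult v ([:0, 0, 1:] * (q - pderiv q))) x" for x
      using frechet_derivative_eq[OF flat_has_derivative[unfolded has_field_derivative_def], of q x v]
      unfolding q by (simp add: flat_def)
    then show ?thesis by auto
  qed
qed auto

text \<open>Since exp (-1/(k x)) tends to 1 for every x > 0, dilating the flat function already
  approximates indicators of boxes; no partition-of-unity type quotient is needed.\<close>

definition box_cutoff :: "'a::euclidean_space \<Rightarrow> 'a \<Rightarrow> real \<Rightarrow> 'a \<Rightarrow> complex" where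
  "box_cutoff a b k u = (\<Prod>i\<in>Basis. of_real (flat 1 (k * ((u - a) \<bullet> i)) * flat 1 (k * ((b - u) \<bullet> i))))"

lemma flat_1_bounds: "0 \<le> flat 1 x" "flat 1 x \<le> 1"
  by (auto simp: flat_def)

lemma box_cutoff_le_1: "cmod (box_cutoff a b k u) \<le> 1"
  unfolding box_cutoff_def prod_norm[symmetric]
  by (intro prod_le_1 conjI norm_ge_zero) (auto simp: norm_mult abs_mult flat_1_bounds intro!: mult_le_one)

lemma box_cutoff_outside:
  assumes "k > 0" "u \<notin> box a b"
  shows "box_cutoff a b k u = 0"
proof -
  obtain i where i: "i \<in> Basis" "\<not> (a \<bullet> i < u \<bullet> i \<and> u \<bullet> i < b \<bullet> i)"
    using assms(2) by (auto simp: mem_box)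
  have "flat 1 (k * ((u - a) \<bullet> i)) * flat 1 (k * ((b - u) \<bullet> i)) = 0"
    using i(2) \<open>k > 0\<close> by (auto simp: flat_def inner_diff_left zero_less_mult_iff)
  then show ?thesis
    unfolding box_cutoff_def using i(1) by (intro prod_zero) (auto intro!: bexI[of _ i])
qed

text \<open>As the box is open, both sides vanish on its boundary and the convergence has no
  exceptional points. \<open>Suc k\<close> keeps the dilation factor positive.\<close>

lemma box_cutoff_tendsto: "(\<lambda>k. box_cutoff a b (real (Suc k)) u) \<longlonglongrightarrow> indicator (box a b) u"
proof (cases "u \<in> box a b")
  case True
  have *: "(\<lambda>k. flat 1 (real (Suc k) * x)) \<longlonglongrightarrow> 1" if "x > 0" for x
  proof -
    have "(\<lambda>k. exp (- (inverse (real (Suc k)) * inverse x))) \<longlonglongrightarrow> exp (- (0 * inverse x))"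
      by (intro tendsto_intros LIMSEQ_inverse_real_of_nat)
    moreover have "flat 1 (real (Suc k) * x) = exp (- (inverse (real (Suc k)) * inverse x))" for k
      using that by (simp add: flat_def divide_inverse)
    ultimately show ?thesis by simp
  qed
  have "(\<lambda>k. box_cutoff a b (real (Suc k)) u) \<longlonglongrightarrow> (\<Prod>i\<in>(Basis :: 'a set). of_real (1 * 1))"
    unfolding box_cutoff_def using True
    by (intro tendsto_prod tendsto_of_real tendsto_mult *) (auto simp: mem_box inner_diff_left)
  then show ?thesis using True by simp
qed (simp add: box_cutoff_outside)

lemma smooth_fun_box_cutoff: "smooth_fun (box_cutoff a b k)"
proof -
  have "smooth_fun (\<lambda>u. flat 1 (k * (u \<bullet> i) + - (k * (a \<bullet> i))))" 
       "smooth_fun (\<lambda>u. flat 1 (- k * (u \<bullet> i) + k * (b \<bullet> i)))" for i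
    by (intro smooth_fun_affine smooth_fun_flat bounded_linear_mult_right
        bounded_linear_compose[OF _ bounded_linear_inner_left])+
  then have "smooth_fun (\<lambda>u. flat 1 (k * ((u - a) \<bullet> i)))" "smooth_fun (\<lambda>u. flat 1 (k * ((b - u) \<bullet> i)))" for i
    by (simp_all add: inner_diff_left right_diff_distrib algebra_simps)
  then show ?thesis
    unfolding box_cutoff_def
    by (intro smooth_fun_prod smooth_fun_linear_compose[OF bounded_linear_of_real] smooth_fun_mult)
qed

lemma test_fun_box_cutoff: "k > 0 \<Longrightarrow> test_fun (box_cutoff a b k)"
  unfolding test_fun_def using smooth_fun_box_cutoff box_cutoff_outside[of k _ a b]
  by (blast intro: bounded_subset[OF bounded_box[of a b]])

section \<open>Test functions and functions of bounded support\<close>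

lemma test_fun_support:
  assumes "test_fun \<phi>"
  obtains R where "\<And>X. R < norm X \<Longrightarrow> \<phi> X = 0"
proof -
  have "bounded {X. \<phi> X \<noteq> 0}" using assms by (simp add: test_fun_def)
  then obtain R where "\<forall>X\<in>{X. \<phi> X \<noteq> 0}. norm X \<le> R" unfolding bounded_iff by blast
  then show ?thesis by (intro that[of R]) force
qed

lemma test_fun_continuous: "test_fun \<phi> \<Longrightarrow> continuous_on S \<phi>"
  by (simp add: test_fun_def smooth_fun_continuous)

lemma test_fun_has_derivative:
  "test_fun \<phi> \<Longrightarrow> (\<phi> has_derivative frechet_derivative \<phi> (at X)) (at X)"
  by (simp add: test_fun_def smooth_fun_has_derivative)

lemma test_fun_cmult:
  assumes "test_fun \<phi>" shows "test_fun (\<lambda>X. c * \<phi> X)"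
proof -
  have "bounded {X. c * \<phi> X \<noteq> 0}"
    using assms by (auto simp: test_fun_def intro: bounded_subset)
  then show ?thesis
    using assms by (auto simp: test_fun_def intro: smooth_fun_linear_compose bounded_linear_mult_right)
qed

text \<open>The strict inequality in the support bound makes the outer region open, so that
  vanishing of the function there passes to its derivative.\<close>

lemma test_fun_deriv:
  assumes "test_fun \<phi>" shows "test_fun (\<lambda>X. frechet_derivative \<phi> (at X) v)"
proof -
  obtain R where R: "\<And>X. R < norm X \<Longrightarrow> \<phi> X = 0"
    using test_fun_support[OF assms] by blast
  have "frechet_derivative \<phi> (at X) v = 0" if "R < norm X" for X
  proof -
    have "open {X :: 'a. R < norm X}"
      by (intro open_Collect_less continuous_intros)
    then have "(\<phi> has_derivative (\<lambda>_. 0)) (at X)"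
      by (rule has_derivative_transform_within_open[OF has_derivative_const[of 0]])
        (use that R in auto)
    then show ?thesis by (rule frechet_derivative_eq)
  qed
  then have "{X. frechet_derivative \<phi> (at X) v \<noteq> 0} \<subseteq> cball 0 R"
    by (auto simp: not_less[symmetric])
  then show ?thesis
    using assms by (auto simp: test_fun_def intro: smooth_fun_deriv bounded_subset[OF bounded_cball])
qed

lemma continuous_bounded_support_bound:
  fixes f :: "'a::euclidean_space \<Rightarrow> complex"
  assumes "continuous_on UNIV f" "\<And>X. R < norm X \<Longrightarrow> f X = 0"
  obtains B where "0 \<le> B" "\<And>X. cmod (f X) \<le> B"
proof -
  have "bounded (f ` cball 0 R)"
    by (intro compact_imp_bounded compact_continuous_image compact_cball continuous_on_subset[OF assms(1)]) auto
  then obtain B where B: "\<And>X. X \<in> cball 0 R \<Longrightarrow> cmod (f X) \<le> B"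
    unfolding bounded_iff by blast
  show ?thesis
  proof (rule that[of "max B 0"])
    show "cmod (f X) \<le> max B 0" for X
      using B[of X] assms(2)[of X] by (cases "norm X \<le> R") auto
  qed simp
qed

lemma integrable_indicator_cball:
  "integrable lborel (\<lambda>X::'a::euclidean_space. c * indicator (cball 0 R) X :: real)"
  using emeasure_lborel_cball_finite[of "0::'a" R]
  by (intro integrable_mult_right integrable_real_indicator) auto

lemma L2_fun_dominated:
  fixes f :: "'a::euclidean_space \<Rightarrow> complex"
  assumes "f \<in> borel_measurable lborel" "\<And>X. cmod (f X) \<le> B * indicator (cball 0 R) X"
  shows "L2_fun f"
proof (rule L2_fun_bound[OF assms(1) integrable_indicator_cball[of "B\<^sup>2" R]])
  fix X
  have "(cmod (f X))\<^sup>2 \<le> (B * indicator (cball 0 R) X)\<^sup>2"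
    by (intro power_mono assms(2) norm_ge_zero)
  then show "(cmod (f X))\<^sup>2 \<le> B\<^sup>2 * indicator (cball 0 R) X"
    by (cases "X \<in> cball 0 R") auto
qed

lemma L2_fun_continuous_bounded_support:
  assumes "continuous_on UNIV f" "\<And>X. R < norm X \<Longrightarrow> f X = 0"
  shows "L2_fun f"
proof -
  obtain B where B: "0 \<le> B" "\<And>X. cmod (f X) \<le> B"
    using continuous_bounded_support_bound[OF assms] by blast
  show ?thesis
  proof (rule L2_fun_dominated)
    show "f \<in> borel_measurable lborel"
      using borel_measurable_continuous_onI[OF assms(1)] by simp
    show "cmod (f X) \<le> B * indicator (cball 0 R) X" for X
      using B assms(2)[of X] by (auto simp: indicator_def)
  qed
qed

lemma L2_fun_test: "test_fun \<phi> \<Longrightarrow> L2_fun \<phi>"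
  by (metis L2_fun_continuous_bounded_support test_fun_continuous test_fun_support)

section \<open>The tangential Cauchy--Riemann equation\<close>

text \<open>For a profile along one vector a, linearity turns the moving direction
  \<open>p' x a\<close> into a fixed one with a scalar coefficient. Taking a = (b, 1) gives the
  large model and a = 1 the one-codimensional one, so both are treated at once.\<close>

lemma Lbar_scaleR:
  fixes p :: "real \<Rightarrow> real" and a :: "'v::euclidean_space"
  assumes p: "smooth_fun p" and \<phi>: "test_fun \<phi>"
  shows "Lbar (\<lambda>x. p x *\<^sub>R a) \<phi> X =
    frechet_derivative \<phi> (at X) (1, 0, 0)
    + \<i> * (frechet_derivative \<phi> (at X) (0, 1, 0)
           - of_real (frechet_derivative p (at (fst X)) 1) * frechet_derivative \<phi> (at X) (0, 0, a))"
proof (cases X)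
  case (fields x y t)
  have "frechet_derivative (\<lambda>x. p x *\<^sub>R a) (at x) 1 = frechet_derivative p (at x) 1 *\<^sub>R a"
    by (rule frechet_derivative_eq) (intro has_derivative_scaleR_left smooth_fun_has_derivative p)
  moreover have "frechet_derivative \<phi> (at X) (0, 0, c *\<^sub>R a) = c *\<^sub>R frechet_derivative \<phi> (at X) (0, 0, a)" for c
    using linear_scale[OF has_derivative_linear[OF test_fun_has_derivative[OF \<phi>]], of X c "(0, 0, a)"]
    by simp
  ultimately show ?thesis
    by (simp add: Lbar_def fields scaleR_conv_of_real)
qed

text \<open>The coefficient p' may be unbounded, but it is continuous and meets a factor of bounded
  support.\<close>

lemma L2_fun_Lbar:
  fixes p :: "real \<Rightarrow> real"
  assumes p: "smooth_fun p" and \<phi>: "test_fun \<phi>"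
  shows "L2_fun (Lbar (\<lambda>x. p x *\<^sub>R a) \<phi>)"
proof -
  note D = test_fun_deriv[OF \<phi>]
  obtain R where R: "\<And>X. R < norm X \<Longrightarrow> frechet_derivative \<phi> (at X) (0, 0, a) = 0"
    using test_fun_support[OF D] by blast
  have "continuous_on UNIV (\<lambda>X. frechet_derivative p (at (fst X)) 1)"
    by (rule continuous_on_compose2[OF smooth_fun_continuous[OF smooth_fun_deriv[OF p]]])
      (auto intro!: continuous_intros)
  then have "L2_fun (\<lambda>X. of_real (frechet_derivative p (at (fst X)) 1) * frechet_derivative \<phi> (at X) (0, 0, a))"
    by (intro L2_fun_continuous_bounded_support[of _ R] continuous_intros test_fun_continuous D)
      (auto simp: R)
  then show ?thesis
    unfolding Lbar_scaleR[OF p \<phi>, abs_def]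
    by (intro L2_fun_add L2_fun_cmult L2_fun_diff L2_fun_test[OF D])
qed

lemma CR_spaceD:
  assumes "f \<in> CR_space P"
  shows "L2_fun f" "test_fun \<phi> \<Longrightarrow> (\<integral>X. f X * Lbar P \<phi> X \<partial>lborel) = 0"
  using assms by (auto simp: CR_space_def)

text \<open>The space is a common kernel of the pairings with the functions
  \<open>Lbar P phi\<close>. As these are square integrable, Cauchy-Schwarz makes each pairing
  continuous in the L2 norm.\<close>

lemma CR_closed_subspace:
  fixes p :: "real \<Rightarrow> real" and a :: "'v::euclidean_space"
  assumes p: "smooth_fun p"
  shows "L2_closed_subspace (CR_space (\<lambda>x. p x *\<^sub>R a))"
proof
  let ?P = "\<lambda>x. p x *\<^sub>R a"
  note I = L2_mult_integrable[OF _ L2_fun_Lbar[OF p]]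
  show "(\<lambda>X. f X + g X) \<in> CR_space ?P" if "f \<in> CR_space ?P" "g \<in> CR_space ?P" for f g
    using that by (auto simp: CR_space_def distrib_right I intro: L2_fun_add)
  show "(\<lambda>X. c * f X) \<in> CR_space ?P" if "f \<in> CR_space ?P" for f c
    using that by (auto simp: CR_space_def mult.assoc intro: L2_fun_cmult)
  fix h g assume h: "\<And>k. h k \<in> CR_space ?P" and g: "L2_fun g"
    and lim: "(\<lambda>k. L2_sq (\<lambda>X. h k X - g X)) \<longlonglongrightarrow> 0"
  have "(\<integral>X. g X * Lbar ?P \<phi> X \<partial>lborel) = 0" if \<phi>: "test_fun \<phi>" for \<phi>
  proof -
    have "cmod (\<integral>X. g X * Lbar ?P \<phi> X \<partial>lborel)
       \<le> sqrt (L2_sq (\<lambda>X. h k X - g X)) * sqrt (L2_sq (Lbar ?P \<phi>))" for k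
    proof -
      have hk: "L2_fun (h k)" using h CR_spaceD by blast
      have "(\<integral>X. (h k X - g X) * Lbar ?P \<phi> X \<partial>lborel) = - (\<integral>X. g X * Lbar ?P \<phi> X \<partial>lborel)"
        using CR_spaceD(2)[OF h \<phi>, of k] I[OF hk \<phi>] I[OF g \<phi>] by (simp add: left_diff_distrib)
      then show ?thesis
        using L2_Cauchy_Schwarz[OF L2_fun_diff[OF hk g] L2_fun_Lbar[OF p \<phi>, of a]] by simp
    qed
    moreover have "(\<lambda>k. sqrt (L2_sq (\<lambda>X. h k X - g X)) * sqrt (L2_sq (Lbar ?P \<phi>))) \<longlonglongrightarrow> sqrt 0 * sqrt (L2_sq (Lbar ?P \<phi>))"
      by (intro tendsto_intros lim)
    ultimately have "cmod (\<integral>X. g X * Lbar ?P \<phi> X \<partial>lborel) \<le> sqrt 0 * sqrt (L2_sq (Lbar ?P \<phi>))"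
      by (intro tendsto_lowerbound[OF _ always_eventually]) auto
    then show ?thesis by simp
  qed
  then show "g \<in> CR_space ?P"
    using g by (simp add: CR_space_def)
qed (auto simp: CR_space_def L2_fun_zero)

text \<open>Existence discharges the choice in the definition; later arguments about
  \<open>szego_proj\<close> use only the relation \<open>is_proj\<close>.\<close>

lemma szego_proj_is_proj:
  fixes p :: "real \<Rightarrow> real"
  assumes p: "smooth_fun p" and "L2_fun f"
  shows "is_proj (CR_space (\<lambda>x. p x *\<^sub>R a)) f (szego_proj (\<lambda>x. p x *\<^sub>R a) f)"
proof -
  interpret L2_closed_subspace "CR_space (\<lambda>x. p x *\<^sub>R a)"
    by (rule CR_closed_subspace[OF p])
  from ex_is_proj[OF assms(2)] show ?thesis
    unfolding szego_proj_def is_proj_def by (rule someI_ex)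
qed

section \<open>The shear\<close>

text \<open>The invariant coordinate u = s - t_n b comes first, so that a point splits as (u, Y)
  with Y a point of the one-codimensional model. It is constant along the direction (b, 1) of the
  operator.\<close>

definition shear :: "'u::euclidean_space \<Rightarrow> 'u \<times> real \<times> real \<times> real \<Rightarrow> real \<times> real \<times> 'u \<times> real" where
  "shear b W = (fst (snd W), fst (snd (snd W)), fst W + snd (snd (snd W)) *\<^sub>R b, snd (snd (snd W)))"

definition unshear :: "'u::euclidean_space \<Rightarrow> real \<times> real \<times> 'u \<times> real \<Rightarrow> 'u \<times> real \<times> real \<times> real" where
  "unshear b X = (fst (snd (snd X)) - snd (snd (snd X)) *\<^sub>R b, fst X, fst (snd X), snd (snd (snd X)))"

lemma unshear_shear [simp]: "unshear b (shear b W) = W"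
  by (simp add: shear_def unshear_def)

lemma shear_unshear [simp]: "shear b (unshear b X) = X"
  by (simp add: shear_def unshear_def)

lemma bounded_linear_shear: "bounded_linear (shear b)"
  unfolding shear_def
  by (intro bounded_linear_Pair bounded_linear_add bounded_linear_compose[OF bounded_linear_scaleR_left]
      bounded_linear_fst_comp bounded_linear_snd_comp bounded_linear_fst bounded_linear_snd)

lemma bounded_linear_unshear: "bounded_linear (unshear b)"
  unfolding unshear_def
  by (intro bounded_linear_Pair bounded_linear_sub bounded_linear_compose[OF bounded_linear_scaleR_left]
      bounded_linear_fst_comp bounded_linear_snd_comp bounded_linear_fst bounded_linear_snd)

lemma measurable_shear [measurable]: "shear b \<in> borel \<rightarrow>\<^sub>M borel"
  by (intro borel_measurable_continuous_onI linear_continuous_on bounded_linear_shear)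

lemma measurable_unshear [measurable]: "unshear b \<in> borel \<rightarrow>\<^sub>M borel"
  by (intro borel_measurable_continuous_onI linear_continuous_on bounded_linear_unshear)

lemma norm_snd_le_shear: "norm (snd W) \<le> norm (shear b W)"
proof (cases W)
  case (fields u x y t)
  show ?thesis
    by (simp add: fields shear_def norm_Pair)
qed

text \<open>The constant comes from u = (u + t b) - t b. Together with the bound on
  \<open>snd W\<close>, it confines a sheared test function to bounded ranges of both u and
  Y.\<close>

lemma norm_fst_le_shear: "norm (fst W) \<le> (1 + norm b) * norm (shear b W)"
proof (cases W)
  case (fields u x y t)
  let ?N = "norm (shear b W)"
  have "norm (u + t *\<^sub>R b) \<le> ?N" "\<bar>t\<bar> \<le> ?N"
    using norm_fst_le[of "u + t *\<^sub>R b" t] norm_snd_le[of t "u + t *\<^sub>R b"]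
      norm_snd_le[of "(u + t *\<^sub>R b, t)" y] norm_snd_le[of "(y, u + t *\<^sub>R b, t)" x]
    by (auto simp: fields shear_def)
  moreover have "norm u \<le> norm (u + t *\<^sub>R b) + norm (t *\<^sub>R b)"
    using norm_triangle_ineq4[of "u + t *\<^sub>R b" "t *\<^sub>R b"] by simp
  moreover have "norm (t *\<^sub>R b) \<le> ?N * norm b"
    using \<open>\<bar>t\<bar> \<le> ?N\<close> by (simp add: mult_right_mono)
  ultimately show ?thesis
    by (simp add: fields algebra_simps)
qed

section \<open>Invariance of Lebesgue measure under the shear\<close>

lemma nn_integral_lborel_translate:
  fixes c :: "'a::euclidean_space"
  assumes [measurable]: "f \<in> borel_measurable borel"
  shows "(\<integral>\<^sup>+u. f (u + c) \<partial>lborel) = (\<integral>\<^sup>+u. f u \<partial>lborel)"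
proof -
  have "(\<integral>\<^sup>+u. f u \<partial>lborel) = (\<integral>\<^sup>+u. f u \<partial>distr lborel borel ((+) c))"
    by (simp add: lborel_distr_plus)
  also have "\<dots> = (\<integral>\<^sup>+u. f (c + u) \<partial>lborel)"
    by (rule nn_integral_distr) auto
  finally show ?thesis by (simp add: add.commute)
qed

lemma nn_integral_lborel_fst:
  fixes f :: "'a::euclidean_space \<times> 'b::euclidean_space \<Rightarrow> ennreal"
  assumes [measurable]: "f \<in> borel_measurable borel"
  shows "(\<integral>\<^sup>+W. f W \<partial>lborel) = (\<integral>\<^sup>+u. \<integral>\<^sup>+Y. f (u, Y) \<partial>lborel \<partial>lborel)"
    and "(\<integral>\<^sup>+W. f W \<partial>lborel) = (\<integral>\<^sup>+Y. \<integral>\<^sup>+u. f (u, Y) \<partial>lborel \<partial>lborel)"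
proof -
  have m: "f \<in> borel_measurable (lborel \<Otimes>\<^sub>M lborel)"
    by (simp add: lborel_prod)
  show "(\<integral>\<^sup>+W. f W \<partial>lborel) = (\<integral>\<^sup>+u. \<integral>\<^sup>+Y. f (u, Y) \<partial>lborel \<partial>lborel)"
    using lborel.nn_integral_fst[OF m] by (simp add: lborel_prod)
  show "(\<integral>\<^sup>+W. f W \<partial>lborel) = (\<integral>\<^sup>+Y. \<integral>\<^sup>+u. f (u, Y) \<partial>lborel \<partial>lborel)"
    using lborel_pair.nn_integral_snd[OF m] by (simp add: lborel_prod)
qed

text \<open>For fixed Y the shear only translates u, so integrating over u first removes it.\<close>

lemma nn_integral_shear:
  fixes b :: "'u::euclidean_space"
  assumes f [measurable]: "f \<in> borel_measurable borel"
  shows "(\<integral>\<^sup>+W. f (shear b W) \<partial>lborel) = (\<integral>\<^sup>+X. f X \<partial>lborel)"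
proof -
  have [measurable]: "(\<lambda>u. f (x, y, u, t)) \<in> borel_measurable borel" for x y t
    by measurable
  have m [measurable]: "(\<lambda>Y::real \<times> real \<times> real. \<integral>\<^sup>+u. f (fst Y, fst (snd Y), u, snd (snd Y)) \<partial>lborel) \<in> borel_measurable borel"
  proof -
    have "(\<lambda>Z :: (real \<times> real \<times> real) \<times> 'u. f (fst (fst Z), fst (snd (fst Z)), snd Z, snd (snd (fst Z)))) \<in> borel_measurable lborel"
      unfolding measurable_lborel2
      by (rule measurable_compose[OF borel_measurable_continuous_onI f]) (intro continuous_intros)
    then show ?thesis
      using lborel.borel_measurable_nn_integral[of "\<lambda>Y u. f (fst Y, fst (snd Y), u, snd (snd Y))" lborel]
      by (simp add: lborel_prod case_prod_beta')
  qed
  have "(\<integral>\<^sup>+W. f (shear b W) \<partial>lborel) = (\<integral>\<^sup>+Y. \<integral>\<^sup>+u. f (shear b (u, Y)) \<partial>lborel \<partial>lborel)"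
    by (rule nn_integral_lborel_fst(2)) measurable
  also have "\<dots> = (\<integral>\<^sup>+Y. \<integral>\<^sup>+u. f (fst Y, fst (snd Y), u, snd (snd Y)) \<partial>lborel \<partial>lborel)"
  proof (rule nn_integral_cong)
    fix Y :: "real \<times> real \<times> real"
    show "(\<integral>\<^sup>+u. f (shear b (u, Y)) \<partial>lborel) = (\<integral>\<^sup>+u. f (fst Y, fst (snd Y), u, snd (snd Y)) \<partial>lborel)"
      using nn_integral_lborel_translate[of "\<lambda>u. f (fst Y, fst (snd Y), u, snd (snd Y))" "snd (snd Y) *\<^sub>R b"]
      by (simp add: shear_def)
  qed
  \<comment> \<open>From here on Tonelli's theorem only moves the u-integration to its place in the
    nested product x, y, (u, t).\<close>
  also have "\<dots> = (\<integral>\<^sup>+x. \<integral>\<^sup>+Z. \<integral>\<^sup>+u. f (x, fst Z, u, snd Z) \<partial>lborel \<partial>lborel \<partial>lborel)"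
    by (subst nn_integral_lborel_fst(1)) simp_all
  also have "\<dots> = (\<integral>\<^sup>+x. \<integral>\<^sup>+y. \<integral>\<^sup>+t. \<integral>\<^sup>+u. f (x, y, u, t) \<partial>lborel \<partial>lborel \<partial>lborel \<partial>lborel)"
  proof (rule nn_integral_cong)
    fix x :: real
    have "(\<lambda>Z. (x, Z)) \<in> borel_measurable borel"
      by (intro borel_measurable_continuous_onI continuous_intros)
    from measurable_compose[OF this m]
    show "(\<integral>\<^sup>+Z. \<integral>\<^sup>+u. f (x, fst Z, u, snd Z) \<partial>lborel \<partial>lborel) =
        (\<integral>\<^sup>+y. \<integral>\<^sup>+t. \<integral>\<^sup>+u. f (x, y, u, t) \<partial>lborel \<partial>lborel \<partial>lborel)"
      by (subst nn_integral_lborel_fst(1)) simp_all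
  qed
  also have "\<dots> = (\<integral>\<^sup>+x. \<integral>\<^sup>+y. \<integral>\<^sup>+Z. f (x, y, Z) \<partial>lborel \<partial>lborel \<partial>lborel)"
    by (intro nn_integral_cong nn_integral_lborel_fst(2)[symmetric] measurable_compose[OF _ f]
        borel_measurable_continuous_onI continuous_intros)
  also have "\<dots> = (\<integral>\<^sup>+x. \<integral>\<^sup>+Z. f (x, Z) \<partial>lborel \<partial>lborel)"
    by (intro nn_integral_cong nn_integral_lborel_fst(1)[symmetric] measurable_compose[OF _ f]
        borel_measurable_continuous_onI continuous_intros)
  also have "\<dots> = (\<integral>\<^sup>+X. f X \<partial>lborel)"
    by (rule nn_integral_lborel_fst(1)[symmetric]) simp
  finally show ?thesis .
qed

lemma distr_shear: "distr lborel lborel (shear b) = lborel"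
proof (rule measure_eqI)
  fix A assume "A \<in> sets (distr lborel lborel (shear b))"
  then have A [measurable]: "A \<in> sets borel" by simp
  have "emeasure (distr lborel lborel (shear b)) A = (\<integral>\<^sup>+X. indicator A X \<partial>distr lborel lborel (shear b))"
    by simp
  also have "\<dots> = (\<integral>\<^sup>+W. indicator A (shear b W) \<partial>lborel)"
    by (rule nn_integral_distr) auto
  also have "\<dots> = emeasure lborel A"
    by (subst nn_integral_shear) auto
  finally show "emeasure (distr lborel lborel (shear b)) A = emeasure lborel A" .
qed simp

lemma integral_shear:
  fixes f :: "real \<times> real \<times> 'u::euclidean_space \<times> real \<Rightarrow> 'c::{banach, second_countable_topology}"
  assumes [measurable]: "f \<in> borel_measurable borel"
  shows "(\<integral>X. f X \<partial>lborel) = (\<integral>W. f (shear b W) \<partial>lborel)"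
    and "integrable lborel f \<longleftrightarrow> integrable lborel (\<lambda>W. f (shear b W))"
  using integral_distr[of "shear b" lborel lborel f] integrable_distr_eq[of "shear b" lborel lborel f]
  by (simp_all add: distr_shear)

lemma L2_shear:
  fixes b :: "'u::euclidean_space"
  assumes [measurable]: "f \<in> borel_measurable borel"
  shows "L2_fun f \<longleftrightarrow> L2_fun (\<lambda>W. f (shear b W))" and "L2_sq f = L2_sq (\<lambda>W. f (shear b W))"
  using integral_shear[of "\<lambda>X. (cmod (f X))\<^sup>2" b] by (auto simp: L2_fun_def L2_sq_def)

lemma lborel_Fubini:
  fixes f :: "'a::euclidean_space \<times> 'b::euclidean_space \<Rightarrow> 'c::{banach, second_countable_topology}"
  assumes "integrable lborel f"
  shows "(\<integral>W. f W \<partial>lborel) = (\<integral>u. \<integral>Y. f (u, Y) \<partial>lborel \<partial>lborel)"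
    and "(\<integral>W. f W \<partial>lborel) = (\<integral>Y. \<integral>u. f (u, Y) \<partial>lborel \<partial>lborel)"
    and "integrable lborel (\<lambda>u. \<integral>Y. f (u, Y) \<partial>lborel)"
proof -
  have i: "integrable (lborel \<Otimes>\<^sub>M lborel) f"
    using assms by (simp add: lborel_prod)
  show "(\<integral>W. f W \<partial>lborel) = (\<integral>u. \<integral>Y. f (u, Y) \<partial>lborel \<partial>lborel)"
    using lborel_pair.integral_fst'[OF i] by (simp add: lborel_prod)
  show "(\<integral>W. f W \<partial>lborel) = (\<integral>Y. \<integral>u. f (u, Y) \<partial>lborel \<partial>lborel)"
    using lborel_pair.integral_snd[of "\<lambda>u Y. f (u, Y)"] i by (simp add: lborel_prod)
  show "integrable lborel (\<lambda>u. \<integral>Y. f (u, Y) \<partial>lborel)"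
    using lborel_pair.integrable_fst'[OF i] .
qed

lemma borel_measurable_compose_fst_snd:
  fixes f :: "'a::euclidean_space \<Rightarrow> 'c::topological_space" and g :: "'b::euclidean_space \<Rightarrow> 'c"
  shows "f \<in> borel_measurable borel \<Longrightarrow> (\<lambda>W. f (fst (W :: 'a \<times> 'b))) \<in> borel_measurable borel"
    and "g \<in> borel_measurable borel \<Longrightarrow> (\<lambda>W. g (snd (W :: 'a \<times> 'b))) \<in> borel_measurable borel"
  by (rule measurable_compose[OF borel_measurable_continuous_onI], intro continuous_intros, assumption)+

lemma L2_fun_tensor:
  fixes \<zeta> :: "'a::euclidean_space \<Rightarrow> complex" and f :: "'b::euclidean_space \<Rightarrow> complex"
  assumes "L2_fun \<zeta>" "L2_fun f"
  shows "L2_fun (\<lambda>W. \<zeta> (fst W) * f (snd W))"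
proof (rule L2_funI)
  have [measurable]: "\<zeta> \<in> borel_measurable borel" "f \<in> borel_measurable borel"
    using assms by (auto simp: L2_fun_def)
  have m [measurable]: "(\<lambda>W. \<zeta> (fst W) * f (snd W)) \<in> borel_measurable borel"
    by (intro borel_measurable_times borel_measurable_compose_fst_snd) auto
  then show "(\<lambda>W. \<zeta> (fst W) * f (snd W)) \<in> borel_measurable lborel"
    by simp
  show "integrable lborel (\<lambda>W. (cmod (\<zeta> (fst W) * f (snd W)))\<^sup>2)"
  proof (rule integrableI_bounded)
    have "(\<integral>\<^sup>+W. ennreal ((cmod (\<zeta> (fst W) * f (snd W)))\<^sup>2) \<partial>lborel) = 
        (\<integral>\<^sup>+u. \<integral>\<^sup>+Y. ennreal ((cmod (\<zeta> u))\<^sup>2) * ennreal ((cmod (f Y))\<^sup>2) \<partial>lborel \<partial>lborel)"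
      by (subst nn_integral_lborel_fst(1), measurable)
        (simp add: norm_mult power_mult_distrib ennreal_mult)
    also have "\<dots> = ennreal (L2_sq \<zeta> * L2_sq f)"
      by (simp add: nn_integral_cmult nn_integral_multc nn_integral_L2_sq assms ennreal_mult)
    also have "\<dots> < \<infinity>" by simp
    finally show "(\<integral>\<^sup>+W. ennreal (norm ((cmod (\<zeta> (fst W) * f (snd W)))\<^sup>2)) \<partial>lborel) < \<infinity>"
      by simp
  qed measurable
qed

lemma L2_fun_indicator:
  fixes Q :: "'a::euclidean_space set"
  assumes "Q \<in> sets borel" "bounded Q"
  shows "L2_fun (indicator Q)"
proof -
  obtain R where R: "\<And>u. u \<in> Q \<Longrightarrow> norm u \<le> R" using assms(2) by (auto simp: bounded_iff)
  show ?thesis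
    by (rule L2_fun_dominated[of _ 1 R]) (use assms(1) R in \<open>auto simp: indicator_def\<close>)
qed

section \<open>Slices and tensor products of test functions\<close>

lemma shear_slice: "shear b (u, Y) = shear b (0, Y) + (0, 0, u, 0)"
  by (simp add: shear_def)

lemma bounded_linear_shear_slice: "bounded_linear (\<lambda>Y. shear b (0, Y))"
  by (intro bounded_linear_compose[OF bounded_linear_shear] bounded_linear_Pair bounded_linear_zero bounded_linear_ident)

lemma test_fun_slice:
  assumes "test_fun \<phi>" shows "test_fun (\<lambda>Y. \<phi> (shear b (u, Y)))"
proof -
  obtain R where R: "\<And>X. R < norm X \<Longrightarrow> \<phi> X = 0"
    using test_fun_support[OF assms] by blast
  have "{Y. \<phi> (shear b (u, Y)) \<noteq> 0} \<subseteq> cball 0 R"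
  proof
    fix Y assume "Y \<in> {Y. \<phi> (shear b (u, Y)) \<noteq> 0}"
    then have "norm (shear b (u, Y)) \<le> R" using R[of "shear b (u, Y)"] by force
    then show "Y \<in> cball 0 R" using norm_snd_le_shear[of "(u, Y)" b] by simp
  qed
  moreover have "smooth_fun (\<lambda>Y. \<phi> (shear b (0, Y) + (0, 0, u, 0)))"
    using assms by (intro smooth_fun_affine bounded_linear_shear_slice) (simp add: test_fun_def)
  ultimately show ?thesis
    unfolding test_fun_def shear_slice[of b u] by (blast intro: bounded_subset[OF bounded_cball])
qed

text \<open>This is what the shear is made for: along a slice its differential keeps the x and y
  directions and sends the last unit direction to (b, 1), the direction that multiplies p' in the
  large operator.\<close>

lemma Lbar_slice:
  assumes p: "smooth_fun p" and \<phi>: "test_fun \<phi>"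
  shows "Lbar (\<lambda>x. p x *\<^sub>R (b, 1)) \<phi> (shear b (u, Y)) = Lbar p (\<lambda>Y. \<phi> (shear b (u, Y))) Y"
proof -
  have "frechet_derivative (\<lambda>Y. \<phi> (shear b (u, Y))) (at Y) v =
     frechet_derivative \<phi> (at (shear b (u, Y))) (shear b (0, v))" for v
    unfolding shear_slice[of b u]
    by (rule frechet_derivative_eq, rule has_derivative_affine_compose)
      (intro bounded_linear_shear_slice test_fun_has_derivative \<phi>)+
  \<comment> \<open>Writing p as \<open>p x *\<^sub>R 1\<close> brings the one-codimensional
    operator under the common formula.\<close>
  moreover have "Lbar p (\<lambda>Y. \<phi> (shear b (u, Y))) = Lbar (\<lambda>x. p x *\<^sub>R 1) (\<lambda>Y. \<phi> (shear b (u, Y)))"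
    by simp
  ultimately show ?thesis
    unfolding Lbar_scaleR[OF p \<phi>] Lbar_scaleR[OF p test_fun_slice[OF \<phi>]]
    by (simp only: Lbar_scaleR[OF p test_fun_slice[OF \<phi>]]) (simp add: shear_def zero_prod_def)
qed

lemma test_fun_tensor:
  fixes b :: "'u::euclidean_space"
  assumes "test_fun \<zeta>" "test_fun \<theta>"
  shows "test_fun (\<lambda>X. \<zeta> (fst (unshear b X)) * \<theta> (snd (unshear b X)))"
proof -
  have 1: "smooth_fun (\<lambda>X. \<zeta> (fst (unshear b X) + 0))" "smooth_fun (\<lambda>X. \<theta> (snd (unshear b X) + 0))"
    using assms by (auto simp: test_fun_def intro!: smooth_fun_affine
        bounded_linear_fst_comp bounded_linear_snd_comp bounded_linear_unshear simp del: add_0_right)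
  have "{X. \<zeta> (fst (unshear b X)) * \<theta> (snd (unshear b X)) \<noteq> 0} \<subseteq> shear b ` ({u. \<zeta> u \<noteq> 0} \<times> {Y. \<theta> Y \<noteq> 0})"
  proof
    fix X assume "X \<in> {X. \<zeta> (fst (unshear b X)) * \<theta> (snd (unshear b X)) \<noteq> 0}"
    then show "X \<in> shear b ` ({u. \<zeta> u \<noteq> 0} \<times> {Y. \<theta> Y \<noteq> 0})"
      by (intro image_eqI[of _ _ "unshear b X"]) (auto simp: mem_Times_iff)
  qed
  moreover have "bounded (shear b ` ({u. \<zeta> u \<noteq> 0} \<times> {Y. \<theta> Y \<noteq> 0}))"
    using assms by (intro bounded_linear_image bounded_linear_shear bounded_Times) (auto simp: test_fun_def)
  ultimately show ?thesis
    using smooth_fun_mult[OF 1] unfolding test_fun_def by (auto intro: bounded_subset)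
qed

text \<open>On a slice u is frozen, so the first factor is a constant that the operator does not
  differentiate.\<close>

lemma Lbar_tensor:
  assumes p: "smooth_fun p" and "test_fun \<zeta>" "test_fun \<theta>"
  shows "Lbar (\<lambda>x. p x *\<^sub>R (b, 1)) (\<lambda>X. \<zeta> (fst (unshear b X)) * \<theta> (snd (unshear b X))) (shear b (u, Y))
    = \<zeta> u * Lbar p \<theta> Y"
proof -
  have D: "frechet_derivative (\<lambda>Y. \<zeta> u * \<theta> Y) (at Y) v = \<zeta> u * frechet_derivative \<theta> (at Y) v" for v
    by (rule frechet_derivative_eq) (intro has_derivative_mult_right test_fun_has_derivative assms)
  have "Lbar (\<lambda>x. p x *\<^sub>R 1) (\<lambda>Y. \<zeta> u * \<theta> Y) Y = \<zeta> u * Lbar (\<lambda>x. p x *\<^sub>R 1) \<theta> Y"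
    unfolding Lbar_scaleR[OF p test_fun_cmult[OF assms(3)]] Lbar_scaleR[OF p assms(3)] D
    by (simp add: algebra_simps)
  then show ?thesis
    unfolding Lbar_slice[OF p test_fun_tensor[OF assms(2,3)]] by simp
qed

section \<open>Averages in the transverse direction\<close>

text \<open>The cutoffs are dominated by the indicator of their box and converge to it, so K
  integrates to zero over every box. Boxes form an intersection-stable generator of the Borel sets,
  and a Dynkin argument extends this to Q.\<close>

lemma integral_zero_of_cutoffs:
  fixes K :: "'u::euclidean_space \<Rightarrow> complex"
  assumes int: "\<And>a b. integrable lborel (\<lambda>u. indicator (box a b) u * K u)"
    and K: "K \<in> borel_measurable borel"
    and cutoff: "\<And>a b k. k > 0 \<Longrightarrow> (\<integral>u. box_cutoff a b k u * K u \<partial>lborel) = 0"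
    and Q: "Q \<in> sets borel" "bounded Q"
  shows "(\<integral>u. indicator Q u * K u \<partial>lborel) = 0"
proof -
  note [measurable] = K
  have box0: "(\<integral>u. indicator (box a b) u * K u \<partial>lborel) = 0" for a b
  proof -
    have "(\<lambda>k. \<integral>u. box_cutoff a b (real (Suc k)) u * K u \<partial>lborel) \<longlonglongrightarrow> (\<integral>u. indicator (box a b) u * K u \<partial>lborel)"
    proof (rule integral_dominated_convergence)
      show "(\<lambda>u. box_cutoff a b (real (Suc k)) u * K u) \<in> borel_measurable lborel" for k
        unfolding measurable_lborel2
        by (intro borel_measurable_times K borel_measurable_continuous_onI
            smooth_fun_continuous smooth_fun_box_cutoff)
      show "integrable lborel (\<lambda>u. norm (indicator (box a b) u * K u))"
        by (rule integrable_norm[OF int])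
      show "AE u in lborel. (\<lambda>k. box_cutoff a b (real (Suc k)) u * K u) \<longlonglongrightarrow> indicator (box a b) u * K u"
        by (intro AE_I2 tendsto_mult box_cutoff_tendsto tendsto_const)
      show "AE u in lborel. norm (box_cutoff a b (real (Suc k)) u * K u) \<le> norm (indicator (box a b) u * K u)" for k
      proof (rule AE_I2)
        fix u show "norm (box_cutoff a b (real (Suc k)) u * K u) \<le> norm (indicator (box a b) u * K u)"
          using box_cutoff_le_1[of a b "real (Suc k)" u] box_cutoff_outside[of "real (Suc k)" u a b]
          by (cases "u \<in> box a b") (auto simp: norm_mult mult_left_le_one_le)
      qed
    qed measurable
    then show ?thesis
      using cutoff by (simp add: LIMSEQ_const_iff)
  qed
  obtain c where c: "Q \<subseteq> box (- c) c"
    using bounded_subset_box_symmetric[OF Q(2)] by blast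
  \<comment> \<open>K is integrable only on boxes. Cutting it off on a box around Q gives an
    integrable function of total integral zero, as the complement step of the induction
    requires.\<close>
  define K0 where "K0 u = indicator (box (- c) c) u * K u" for u
  have K0i: "integrable lborel K0" unfolding K0_def by (rule int)
  have K0_0: "integral\<^sup>L lborel K0 = 0" unfolding K0_def by (rule box0)
  have si: "set_integrable lborel A K0" if "A \<in> sets borel" for A
    using that K0i unfolding set_integrable_def by (intro integrable_mult_indicator) auto
  have "Int_stable (range (\<lambda>(a, b). box a b :: 'u set))"
    by (auto simp: Int_stable_def box_Int_box)
  moreover have "range (\<lambda>(a, b). box a b :: 'u set) \<subseteq> Pow UNIV"
    by simp
  moreover have "Q \<in> sigma_sets UNIV (range (\<lambda>(a, b). box a b))"
    using Q(1) by (simp add: borel_eq_box)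
  ultimately have "(LINT u:Q|lborel. K0 u) = 0"
  proof (induction rule: sigma_sets_induct_disjoint)
    case (basic A)
    then obtain a b where A: "A = box a b" by auto
    have "\<exists>a' b'. box a b \<inter> box (- c) c = box a' b'"
      by (auto simp: box_Int_box)
    then obtain a' b' where ab: "box a b \<inter> box (- c) c = box a' b'" by blast
    have "indicator A u *\<^sub>R K0 u = indicator (box a' b') u * K u" for u
      unfolding ab[symmetric] A K0_def by (auto simp: indicator_def)
    then show ?case
      using box0 by (simp add: set_lebesgue_integral_def)
  next
    case empty
    show ?case by (simp add: set_lebesgue_integral_def)
  next
    case (compl A)
    then have A: "A \<in> sets borel" by (simp add: borel_eq_box)
    have "indicator (UNIV - A) u *\<^sub>R K0 u = K0 u - indicator A u *\<^sub>R K0 u" for u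
      by (simp add: indicator_def)
    then show ?case
      using compl si[OF A] K0i K0_0 by (simp add: set_lebesgue_integral_def set_integrable_def)
  next
    case (union A)
    then have A: "A i \<in> sets borel" for i by (auto simp: borel_eq_box)
    then have "(LINT u:(\<Union>i. A i)|lborel. K0 u) = (\<Sum>i. LINT u:A i|lborel. K0 u)"
      using union by (intro lebesgue_integral_countable_add si) (auto simp: disjoint_family_on_def)
    then show ?case using union by simp
  qed
  moreover have "indicator Q u *\<^sub>R K0 u = indicator Q u * K u" for u
    using c by (auto simp: K0_def indicator_def)
  ultimately show ?thesis
    by (simp add: set_lebesgue_integral_def)
qed

text \<open>By Cauchy-Schwarz in u, the squared average at Y is at most the measure of Q times the
  integral of |H(u, Y)|^2 over u, and the measure of a bounded set is finite.\<close>

lemma L2_fun_average: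
  fixes H :: "'u::euclidean_space \<times> 'y::euclidean_space \<Rightarrow> complex"
  assumes H: "L2_fun H" and Q: "Q \<in> sets borel" "bounded Q"
  shows "L2_fun (\<lambda>Y. \<integral>u. indicator Q u * H (u, Y) \<partial>lborel)"
proof (rule L2_funI)
  have [measurable]: "H \<in> borel_measurable borel" using L2_fun_measurable[OF H] by simp
  have [measurable]: "Q \<in> sets borel" by fact
  have [measurable]: "(\<lambda>u. H (u, Y)) \<in> borel_measurable borel" for Y
    by measurable
  have swap: "(\<lambda>Z :: 'y \<times> 'u. h (snd Z, fst Z)) \<in> borel_measurable (lborel \<Otimes>\<^sub>M lborel)"
    if "h \<in> borel_measurable borel" for h :: "'u \<times> 'y \<Rightarrow> 'c::topological_space"
    unfolding lborel_prod measurable_lborel2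
    by (rule measurable_compose[OF borel_measurable_continuous_onI that]) (intro continuous_intros)
  have indH: "(\<lambda>W. indicator Q (fst W) * H W) \<in> borel_measurable borel"
    by (intro borel_measurable_times borel_measurable_compose_fst_snd(1)) auto
  show meas: "(\<lambda>Y. \<integral>u. indicator Q u * H (u, Y) \<partial>lborel) \<in> borel_measurable lborel"
    using lborel.borel_measurable_lebesgue_integral[of "\<lambda>Y u. indicator Q u * H (u, Y)" lborel]
      swap[OF indH] by (simp add: case_prod_beta')
  have meas2: "(\<lambda>Y. \<integral>\<^sup>+u. (ennreal (cmod (H (u, Y))))\<^sup>2 \<partial>lborel) \<in> borel_measurable lborel"
    using lborel.borel_measurable_nn_integral[of "\<lambda>Y u. (ennreal (cmod (H (u, Y))))\<^sup>2" lborel]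
      swap[of "\<lambda>W. (ennreal (cmod (H W)))\<^sup>2"] by (simp add: case_prod_beta')
  have pw: "ennreal ((cmod (\<integral>u. indicator Q u * H (u, Y) \<partial>lborel))\<^sup>2)
      \<le> emeasure lborel Q * (\<integral>\<^sup>+u. (ennreal (cmod (H (u, Y))))\<^sup>2 \<partial>lborel)" for Y
  proof -
    have "ennreal (cmod (\<integral>u. indicator Q u * H (u, Y) \<partial>lborel))
       \<le> (\<integral>\<^sup>+u. indicator Q u * ennreal (cmod (H (u, Y))) \<partial>lborel)"
    \<comment> \<open>A slice that is not integrable has Bochner integral 0 by convention, so the
      bound holds for every Y and no exceptional set arises.\<close>
    proof (cases "integrable lborel (\<lambda>u. indicator Q u * H (u, Y))")
      case True
      have "ennreal (norm (indicator Q u * H (u, Y))) = indicator Q u * ennreal (cmod (H (u, Y)))" for u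
        by (simp add: indicator_def)
      then show ?thesis
        using integral_norm_bound_ennreal[OF True] by simp
    qed (simp add: not_integrable_integral_eq)
    then have "ennreal ((cmod (\<integral>u. indicator Q u * H (u, Y) \<partial>lborel))\<^sup>2)
       \<le> (\<integral>\<^sup>+u. indicator Q u * ennreal (cmod (H (u, Y))) \<partial>lborel)\<^sup>2"
      by (simp add: ennreal_power[symmetric] power_mono)
    also have "\<dots> \<le> (\<integral>\<^sup>+u. (indicator Q u)\<^sup>2 \<partial>lborel) * (\<integral>\<^sup>+u. (ennreal (cmod (H (u, Y))))\<^sup>2 \<partial>lborel)"
      by (rule Cauchy_Schwarz_nn_integral) measurable
    also have "(\<integral>\<^sup>+u. (indicator Q u)\<^sup>2 \<partial>lborel) = (\<integral>\<^sup>+u. indicator Q u \<partial>lborel)"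
      by (intro nn_integral_cong) (simp add: indicator_def)
    also have "\<dots> = emeasure lborel Q" by simp
    finally show ?thesis .
  qed
  show "integrable lborel (\<lambda>Y. (cmod (\<integral>u. indicator Q u * H (u, Y) \<partial>lborel))\<^sup>2)"
  proof (rule integrableI_bounded)
    have "(\<integral>\<^sup>+Y. ennreal ((cmod (\<integral>u. indicator Q u * H (u, Y) \<partial>lborel))\<^sup>2) \<partial>lborel)
       \<le> (\<integral>\<^sup>+Y. emeasure lborel Q * (\<integral>\<^sup>+u. (ennreal (cmod (H (u, Y))))\<^sup>2 \<partial>lborel) \<partial>lborel)"
      by (intro nn_integral_mono pw)
    also have "\<dots> = emeasure lborel Q * (\<integral>\<^sup>+Y. \<integral>\<^sup>+u. (ennreal (cmod (H (u, Y))))\<^sup>2 \<partial>lborel \<partial>lborel)"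
      by (rule nn_integral_cmult[OF meas2])
    also have "(\<integral>\<^sup>+Y. \<integral>\<^sup>+u. (ennreal (cmod (H (u, Y))))\<^sup>2 \<partial>lborel \<partial>lborel) = (\<integral>\<^sup>+W. (ennreal (cmod (H W)))\<^sup>2 \<partial>lborel)"
      by (rule nn_integral_lborel_fst(2)[symmetric]) measurable
    also have "\<dots> = ennreal (L2_sq H)"
      using nn_integral_L2_sq[OF H] by (simp add: ennreal_power)
    also have "emeasure lborel Q * \<dots> < \<infinity>"
      using emeasure_bounded_finite[OF Q(2)] by (simp add: ennreal_mult_less_top)
    finally show "(\<integral>\<^sup>+Y. ennreal (norm ((cmod (\<integral>u. indicator Q u * H (u, Y) \<partial>lborel))\<^sup>2)) \<partial>lborel) < \<infinity>"
      by simp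
  qed (use meas in measurable)
qed

text \<open>Individual slices H (shear b (u, \<cdot>)) solve the one-codimensional equation only for almost every u,
  and showing this would need a countable dense set of test functions.  Averages over u avoid both.\<close>

lemma CR_space_average:
  fixes b :: "'u::euclidean_space"
  assumes p: "smooth_fun p" and H: "H \<in> CR_space (\<lambda>x. p x *\<^sub>R (b, 1))"
    and Q: "Q \<in> sets borel" "bounded Q"
  shows "(\<lambda>Y. \<integral>u. indicator Q u * H (shear b (u, Y)) \<partial>lborel) \<in> CR_space p"
proof -
  have HL: "L2_fun H" using CR_spaceD[OF H] by simp
  then have [measurable]: "H \<in> borel_measurable borel" by (auto dest: L2_fun_measurable)
  have H'L: "L2_fun (\<lambda>W. H (shear b W))" using HL L2_shear(1)[of H b] by simp
  have "(\<integral>Y. (\<integral>u. indicator Q u * H (shear b (u, Y)) \<partial>lborel) * Lbar p \<theta> Y \<partial>lborel) = 0"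
    if \<theta>: "test_fun \<theta>" for \<theta>
  proof -
    have LL: "L2_fun (Lbar p \<theta>)" using L2_fun_Lbar[OF p \<theta>, of 1] by simp
    have I: "integrable lborel (\<lambda>W. \<zeta> (fst W) * (H (shear b W) * Lbar p \<theta> (snd W)))"
      if "L2_fun \<zeta>" for \<zeta>
      using L2_mult_integrable[OF H'L L2_fun_tensor[OF that LL]] by (simp add: mult.left_commute)
    \<comment> \<open>Testing H against a product of zeta in u and theta in Y says exactly that K
      integrates to zero against zeta.\<close>
    define K where "K u = (\<integral>Y. H (shear b (u, Y)) * Lbar p \<theta> Y \<partial>lborel)" for u
    have "(\<integral>u. indicator Q u * K u \<partial>lborel) = 0"
    proof (rule integral_zero_of_cutoffs[OF _ _ _ Q])
      show "integrable lborel (\<lambda>u. indicator (box a c) u * K u)" for a c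
        using lborel_Fubini(3)[OF I[OF L2_fun_indicator[OF _ bounded_box]], of a c] by (simp add: K_def)
      have "(\<lambda>W. H (shear b W) * Lbar p \<theta> (snd W)) \<in> borel_measurable borel"
        using L2_fun_measurable[OF LL]
        by (intro borel_measurable_times borel_measurable_compose_fst_snd(2)) auto
      then show "K \<in> borel_measurable borel"
        using lborel.borel_measurable_lebesgue_integral[of "\<lambda>u Y. H (shear b (u, Y)) * Lbar p \<theta> Y" lborel]
        by (simp add: K_def[abs_def] lborel_prod case_prod_beta')
      fix a c :: 'u and k :: real assume k: "k > 0"
      let ?\<zeta> = "box_cutoff a c k"
      note \<zeta> = test_fun_box_cutoff[OF k, of a c]
      let ?\<phi> = "\<lambda>X. ?\<zeta> (fst (unshear b X)) * \<theta> (snd (unshear b X))"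
      let ?P = "\<lambda>x. p x *\<^sub>R (b, 1::real)"
      have "(\<integral>u. ?\<zeta> u * K u \<partial>lborel) = (\<integral>W. ?\<zeta> (fst W) * (H (shear b W) * Lbar p \<theta> (snd W)) \<partial>lborel)"
        using lborel_Fubini(1)[OF I[OF L2_fun_test[OF \<zeta>]]] by (simp add: K_def)
      also have "\<dots> = (\<integral>W. H (shear b W) * Lbar ?P ?\<phi> (shear b W) \<partial>lborel)"
        using Lbar_tensor[OF p \<zeta> \<theta>] by (intro Bochner_Integration.integral_cong) (auto simp: mult_ac)
      also have "\<dots> = (\<integral>X. H X * Lbar ?P ?\<phi> X \<partial>lborel)"
        using L2_fun_measurable[OF L2_fun_Lbar[OF p test_fun_tensor[OF \<zeta> \<theta>]], of "(b, 1)"]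
        by (intro integral_shear(1)[symmetric]) (simp add: borel_measurable_times)
      also have "\<dots> = 0"
        using CR_spaceD(2)[OF H test_fun_tensor[OF \<zeta> \<theta>]] .
      finally show "(\<integral>u. ?\<zeta> u * K u \<partial>lborel) = 0" .
    qed
    moreover have "(\<integral>u. indicator Q u * K u \<partial>lborel)
      = (\<integral>Y. (\<integral>u. indicator Q u * (H (shear b (u, Y)) * Lbar p \<theta> Y) \<partial>lborel) \<partial>lborel)"
      using lborel_Fubini(1,2)[OF I[OF L2_fun_indicator[OF Q]]] by (simp add: K_def)
    \<comment> \<open>This holds for every Y: if the slice is not integrable, both sides are
      0.\<close>
    moreover have "(\<integral>u. indicator Q u * (H (shear b (u, Y)) * Lbar p \<theta> Y) \<partial>lborel)
      = (\<integral>u. indicator Q u * H (shear b (u, Y)) \<partial>lborel) * Lbar p \<theta> Y" for Y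
      by (subst integral_mult_left_zero[symmetric]) (simp add: mult.assoc)
    ultimately show ?thesis by simp
  qed
  then show ?thesis
    using L2_fun_average[OF H'L Q] by (simp add: CR_space_def)
qed

text \<open>The two halves use opposite orders of integration. Membership integrates over Y first,
  because each slice of a test function is a test function for g; orthogonality integrates over u
  first, because it is the u-averages of h that are known to solve the small equation.\<close>

lemma is_proj_tensor:
  fixes b :: "'u::euclidean_space"
  assumes p: "smooth_fun p" and f: "L2_fun f" and proj: "is_proj (CR_space p) f g"
    and Q: "Q \<in> sets borel" "bounded Q"
  shows "is_proj (CR_space (\<lambda>x. p x *\<^sub>R (b, 1)))
    (\<lambda>X. indicator Q (fst (unshear b X)) * f (snd (unshear b X)))
    (\<lambda>X. indicator Q (fst (unshear b X)) * g (snd (unshear b X)))"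
    and L2_fun_unshear_tensor: "L2_fun (\<lambda>X. indicator Q (fst (unshear b X)) * f (snd (unshear b X)))"
proof -
  let ?P = "\<lambda>x. p x *\<^sub>R (b, 1::real)"
  have gC: "g \<in> CR_space p" using proj by (simp add: is_proj_def)
  have g: "L2_fun g" using CR_spaceD[OF gC] by simp
  note ind = L2_fun_indicator[OF Q]
  have meas: "(\<lambda>X. indicator Q (fst (unshear b X)) * h (snd (unshear b X)) :: complex) \<in> borel_measurable borel"
    if "L2_fun h" for h
  proof (rule measurable_compose[OF measurable_unshear])
    show "(\<lambda>W. indicator Q (fst W) * h (snd W) :: complex) \<in> borel_measurable borel"
      using L2_fun_measurable[OF L2_fun_tensor[OF ind that]] by simp
  qed
  have L2T: "L2_fun (\<lambda>X. indicator Q (fst (unshear b X)) * h (snd (unshear b X)))" if "L2_fun h" for h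
    using L2_fun_tensor[OF ind that] L2_shear(1)[OF meas[OF that], of b] by simp
  show "L2_fun (\<lambda>X. indicator Q (fst (unshear b X)) * f (snd (unshear b X)))"
    by (rule L2T[OF f])
  show "is_proj (CR_space ?P)
    (\<lambda>X. indicator Q (fst (unshear b X)) * f (snd (unshear b X)))
    (\<lambda>X. indicator Q (fst (unshear b X)) * g (snd (unshear b X)))"
    unfolding is_proj_def
  proof (intro conjI ballI)
    show "(\<lambda>X. indicator Q (fst (unshear b X)) * g (snd (unshear b X))) \<in> CR_space ?P"
      unfolding CR_space_def
    proof (intro CollectI conjI allI impI L2T[OF g])
      fix \<phi> :: "real \<times> real \<times> 'u \<times> real \<Rightarrow> complex" assume \<phi>: "test_fun \<phi>"
      note i = L2_mult_integrable[OF L2T[OF g] L2_fun_Lbar[OF p \<phi>, of "(b, 1)"]]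
      have m: "(\<lambda>X. indicator Q (fst (unshear b X)) * g (snd (unshear b X)) * Lbar ?P \<phi> X) \<in> borel_measurable borel"
        using borel_measurable_integrable[OF i] by simp
      have "(\<integral>X. indicator Q (fst (unshear b X)) * g (snd (unshear b X)) * Lbar ?P \<phi> X \<partial>lborel)
        = (\<integral>W. indicator Q (fst W) * g (snd W) * Lbar ?P \<phi> (shear b W) \<partial>lborel)"
        using integral_shear(1)[OF m, of b] by simp
      also have "\<dots> = (\<integral>u. (\<integral>Y. indicator Q u * g Y * Lbar ?P \<phi> (shear b (u, Y)) \<partial>lborel) \<partial>lborel)"
        using lborel_Fubini(1)[OF i[unfolded integral_shear(2)[OF m, of b]]] by simp
      also have "\<dots> = (\<integral>u. indicator Q u * (\<integral>Y. g Y * Lbar p (\<lambda>Y. \<phi> (shear b (u, Y))) Y \<partial>lborel) \<partial>lborel)"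
        unfolding Lbar_slice[OF p \<phi>] mult.assoc by simp
      also have "\<dots> = 0"
        using CR_spaceD(2)[OF gC test_fun_slice[OF \<phi>]] by simp
      finally show "(\<integral>X. indicator Q (fst (unshear b X)) * g (snd (unshear b X)) * Lbar ?P \<phi> X \<partial>lborel) = 0" .
    qed
    fix h assume h: "h \<in> CR_space ?P"
    have hL: "L2_fun h" using CR_spaceD[OF h] by simp
    define d where "d Y = f Y - g Y" for Y
    have dL: "L2_fun d" unfolding d_def by (intro L2_fun_diff f g)
    note i = L2_inner_integrable[OF L2T[OF dL] hL]
    have m: "(\<lambda>X. indicator Q (fst (unshear b X)) * d (snd (unshear b X)) * cnj (h X)) \<in> borel_measurable borel"
      using borel_measurable_integrable[OF i] by simp
    have "L2_inner (\<lambda>X. indicator Q (fst (unshear b X)) * f (snd (unshear b X)) -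
        indicator Q (fst (unshear b X)) * g (snd (unshear b X))) h
      = (\<integral>X. indicator Q (fst (unshear b X)) * d (snd (unshear b X)) * cnj (h X) \<partial>lborel)"
      by (simp add: L2_inner_def d_def right_diff_distrib)
    also have "\<dots> = (\<integral>W. indicator Q (fst W) * d (snd W) * cnj (h (shear b W)) \<partial>lborel)"
      using integral_shear(1)[OF m, of b] by simp
    also have "\<dots> = (\<integral>Y. (\<integral>u. indicator Q u * d Y * cnj (h (shear b (u, Y))) \<partial>lborel) \<partial>lborel)"
      using lborel_Fubini(2)[OF i[unfolded integral_shear(2)[OF m, of b]]] by simp
    also have "\<dots> = (\<integral>Y. d Y * cnj (\<integral>u. indicator Q u * h (shear b (u, Y)) \<partial>lborel) \<partial>lborel)"
    proof (rule Bochner_Integration.integral_cong[OF refl])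
      fix Y
      have "(\<integral>u. indicator Q u * d Y * cnj (h (shear b (u, Y))) \<partial>lborel) =
         (\<integral>u. d Y * cnj (indicator Q u * h (shear b (u, Y))) \<partial>lborel)"
        by (intro Bochner_Integration.integral_cong) (auto simp: indicator_def)
      also have "\<dots> = d Y * (\<integral>u. cnj (indicator Q u * h (shear b (u, Y))) \<partial>lborel)"
        by (rule integral_mult_right_zero)
      also have "(\<integral>u. cnj (indicator Q u * h (shear b (u, Y))) \<partial>lborel) =
         cnj (\<integral>u. indicator Q u * h (shear b (u, Y)) \<partial>lborel)"
        by (rule Bochner_Integration.integral_cnj)
      finally show "(\<integral>u. indicator Q u * d Y * cnj (h (shear b (u, Y))) \<partial>lborel) =
        d Y * cnj (\<integral>u. indicator Q u * h (shear b (u, Y)) \<partial>lborel)" .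
    qed
    also have "\<dots> = 0"
      using proj CR_space_average[OF p h Q] by (simp add: is_proj_def L2_inner_def d_def)
    finally show "L2_inner (\<lambda>X. indicator Q (fst (unshear b X)) * f (snd (unshear b X)) -
        indicator Q (fst (unshear b X)) * g (snd (unshear b X))) h = 0" .
  qed
qed

section \<open>Approximation by functions that are simple in the transverse direction\<close>

text \<open>Applied to slices, whose bound and support radius do not depend on u, it yields norms
  bounded uniformly in u.\<close>

lemma L2_sq_bound:
  fixes f :: "'a::euclidean_space \<Rightarrow> complex"
  assumes "f \<in> borel_measurable lborel" "\<And>X. cmod (f X) \<le> B * indicator (cball 0 R) X"
  shows "L2_sq f \<le> B\<^sup>2 * measure lborel (cball (0::'a) R)"
proof -
  have "L2_sq f \<le> (\<integral>X. B\<^sup>2 * indicator (cball (0::'a) R) X \<partial>lborel)"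
    unfolding L2_sq_def
  proof (rule integral_mono)
    show "integrable lborel (\<lambda>X. (cmod (f X))\<^sup>2)"
      by (rule L2_fun_integrable[OF L2_fun_dominated[OF assms]])
    show "integrable lborel (\<lambda>X::'a. B\<^sup>2 * indicator (cball 0 R) X)"
      by (rule integrable_indicator_cball)
    fix X
    show "(cmod (f X))\<^sup>2 \<le> B\<^sup>2 * indicator (cball 0 R) X"
      using assms(2)[of X] by (cases "X \<in> cball 0 R") (auto intro: power_mono)
  qed
  then show ?thesis by simp
qed

lemma L2_sq_dominated_convergence:
  fixes f :: "nat \<Rightarrow> 'a::euclidean_space \<Rightarrow> complex"
  assumes f: "\<And>k. f k \<in> borel_measurable lborel" and g: "g \<in> borel_measurable lborel"
    and bound: "\<And>k X. cmod (f k X) \<le> B * indicator (cball 0 R) X"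
    and lim: "\<And>X. (\<lambda>k. f k X) \<longlonglongrightarrow> g X"
  shows "(\<lambda>k. L2_sq (\<lambda>X. f k X - g X)) \<longlonglongrightarrow> 0"
proof -
  note [measurable] = f g
  have "(\<lambda>k. L2_sq (\<lambda>X. f k X - g X)) \<longlonglongrightarrow> (\<integral>X. 0 \<partial>(lborel :: 'a measure))"
    unfolding L2_sq_def
  proof (rule integral_dominated_convergence)
    show "integrable lborel (\<lambda>X::'a. (2 * B)\<^sup>2 * indicator (cball 0 R) X)"
      by (rule integrable_indicator_cball)
    show "AE X in lborel. (\<lambda>k. (cmod (f k X - g X))\<^sup>2) \<longlonglongrightarrow> 0"
    proof (rule AE_I2)
      fix X
      have "(\<lambda>k. (cmod (f k X - g X))\<^sup>2) \<longlonglongrightarrow> (cmod (g X - g X))\<^sup>2"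
        by (intro tendsto_intros lim)
      then show "(\<lambda>k. (cmod (f k X - g X))\<^sup>2) \<longlonglongrightarrow> 0" by simp
    qed
    show "AE X in lborel. norm ((cmod (f k X - g X))\<^sup>2) \<le> (2 * B)\<^sup>2 * indicator (cball 0 R) X" for k
    proof (rule AE_I2)
      fix X
      \<comment> \<open>The limit inherits the dominating bound, whence the factor 2 in the
        majorant.\<close>
      have "cmod (g X) \<le> B * indicator (cball 0 R) X"
        by (rule tendsto_upperbound[OF tendsto_norm[OF lim]]) (auto intro: always_eventually bound)
      then have "cmod (f k X - g X) \<le> 2 * B * indicator (cball 0 R) X"
        using bound[of k X] norm_triangle_ineq4[of "f k X" "g X"] by simp
      then show "norm ((cmod (f k X - g X))\<^sup>2) \<le> (2 * B)\<^sup>2 * indicator (cball 0 R) X"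
        by (cases "X \<in> cball 0 R") (auto dest: power_mono[of _ _ 2])
    qed
  qed measurable
  then show ?thesis by simp
qed

text \<open>The pairing of the approximate projections with psi has two limits. Contraction on the
  large space gives the left-hand side; contraction on the small space, applied for each u and
  combined with dominated convergence in u, gives the right-hand side.\<close>

theorem szego_pair_slices:
  fixes p :: "real \<Rightarrow> real" and b :: "'u::euclidean_space"
  assumes p: "smooth_fun p" and \<phi>: "test_fun \<phi>" and \<psi>: "test_fun \<psi>"
  shows "szego_pair (\<lambda>x. p x *\<^sub>R (b, 1)) \<phi> \<psi> =
    (\<integral>u. szego_pair p (\<lambda>Y. \<phi> (shear b (u, Y))) (\<lambda>Y. \<psi> (shear b (u, Y))) \<partial>lborel)"
proof -
  define P where "P = (\<lambda>x. p x *\<^sub>R (b, 1 :: real))"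
  define F where "F u Y = \<phi> (shear b (u, Y))" for u Y
  define \<Psi> where "\<Psi> u Y = \<psi> (shear b (u, Y))" for u Y
  define g where "g u = szego_proj p (F u)" for u
  interpret CP: L2_closed_subspace "CR_space P"
    unfolding P_def by (rule CR_closed_subspace[OF p])
  interpret Cp: L2_closed_subspace "CR_space p"
    using CR_closed_subspace[OF p, of "1::real"] by simp
  have F_test: "test_fun (F u)" and \<Psi>_test: "test_fun (\<Psi> u)" for u
    unfolding F_def \<Psi>_def by (intro test_fun_slice \<phi> \<psi>)+
  note FL = L2_fun_test[OF F_test] and \<Psi>L = L2_fun_test[OF \<Psi>_test]
  have g_proj: "is_proj (CR_space p) (F u) (g u)" for u
    unfolding g_def using szego_proj_is_proj[OF p FL[of u], of "1::real"] by simp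
  have gL: "L2_fun (g u)" for u
    using g_proj[of u] CR_spaceD(1) unfolding is_proj_def by blast

  obtain R1 R2 where R1: "\<And>X. R1 < norm X \<Longrightarrow> \<phi> X = 0" and R2: "\<And>X. R2 < norm X \<Longrightarrow> \<psi> X = 0"
    using test_fun_support[OF \<phi>] test_fun_support[OF \<psi>] by metis
  define R where "R = max 0 (max R1 R2)"
  have R: "R \<ge> 0" "\<And>X. R < norm X \<Longrightarrow> \<phi> X = 0" "\<And>X. R < norm X \<Longrightarrow> \<psi> X = 0"
    using R1 R2 by (auto simp: R_def)
  obtain B1 where B1: "0 \<le> B1" "\<And>X. cmod (\<phi> X) \<le> B1"
    using continuous_bounded_support_bound[OF test_fun_continuous[OF \<phi>] R(2)] by blast
  obtain B2 where B2: "0 \<le> B2" "\<And>X. cmod (\<psi> X) \<le> B2"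
    using continuous_bounded_support_bound[OF test_fun_continuous[OF \<psi>] R(3)] by blast
  \<comment> \<open>Beyond this radius in u, \<open>norm_fst_le_shear\<close> puts the sheared point
    outside both supports.\<close>
  define R' where "R' = (1 + norm b) * R"
  have out_u: "R < norm (shear b (u, Y))" if "R' < norm u" for u Y
  proof -
    have "(1 + norm b) * R < (1 + norm b) * norm (shear b (u, Y))"
      using that norm_fst_le_shear[of "(u, Y)" b] by (simp add: R'_def)
    moreover have "0 < 1 + norm b" by (simp add: add_pos_nonneg)
    ultimately show ?thesis using mult_less_cancel_left_pos by blast
  qed
  have out_Y: "R < norm (shear b (u, Y))" if "R < norm Y" for u Y
    using that norm_snd_le_shear[of "(u, Y)" b] by simp
  have F_bound: "cmod (F u Y) \<le> B1 * indicator (cball 0 R) Y"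
   and \<Psi>_bound: "cmod (\<Psi> u Y) \<le> B2 * indicator (cball 0 R) Y" for u Y
    using B1 B2 R(2,3)[OF out_Y, of Y u] by (auto simp: F_def \<Psi>_def indicator_def)
  have F_out: "F u Y = 0" and \<Psi>_out: "\<Psi> u Y = 0" if "u \<notin> cball 0 R'" for u Y
    using R(2,3)[OF out_u, of u Y] that by (auto simp: F_def \<Psi>_def)

  \<comment> \<open>Simple functions converging to the identity of the u-space: replacing u by
    \<open>s k u\<close> in the slice leaves finitely many frozen slices, each with its own
    projection.\<close>
  obtain s where s: "\<And>k. simple_function lborel (s k)" "\<And>u. (\<lambda>k. s k u) \<longlonglongrightarrow> (u :: 'u)"
    using borel_measurable_implies_sequence_metric[of "\<lambda>u::'u. u" lborel 0] by auto
  \<comment> \<open>Level sets of a simple function can be unbounded. Intersecting them with the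
    ball makes them admissible for \<open>is_proj_tensor\<close> and loses nothing in the limit, as
    the slices vanish for u outside it.\<close>
  define Q where "Q k v = {u. s k u = v} \<inter> cball 0 R'" for k v
  have Q: "Q k v \<in> sets borel" "bounded (Q k v)" for k v
  proof -
    have "s k -` {v} \<inter> space lborel \<in> sets lborel"
      by (rule simple_functionD(2)[OF s(1)])
    moreover have "s k -` {v} = {u. s k u = v}" by auto
    ultimately show "Q k v \<in> sets borel" by (simp add: Q_def)
    show "bounded (Q k v)" unfolding Q_def by (rule bounded_Int) simp
  qed
  have fin: "finite (range (s k))" for k
    using simple_functionD(1)[OF s(1)[of k]] by simp
  have Q_sum: "(\<Sum>v\<in>range (s k). indicator (Q k v) u * h v) = indicator (cball 0 R') u * h (s k u)"
    for k u and h :: "'u \<Rightarrow> complex"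
  proof -
    have "(\<Sum>v\<in>range (s k). indicator (Q k v) u * h v) =
      (\<Sum>v\<in>range (s k). if v = s k u then indicator (cball 0 R') u * h v else 0)"
      by (intro sum.cong) (auto simp: Q_def indicator_def)
    also have "\<dots> = indicator (cball 0 R') u * h (s k u)"
      using fin[of k] by simp
    finally show ?thesis .
  qed
  define Fk where "Fk k X = (\<Sum>v\<in>range (s k). indicator (Q k v) (fst (unshear b X)) * F v (snd (unshear b X)))" for k X
  define Gk where "Gk k X = (\<Sum>v\<in>range (s k). indicator (Q k v) (fst (unshear b X)) * g v (snd (unshear b X)))" for k X
  have Fk_shear: "Fk k (shear b W) = indicator (cball 0 R') (fst W) * F (s k (fst W)) (snd W)" for k W
    unfolding Fk_def unshear_shear using Q_sum[of k "fst W" "\<lambda>v. F v (snd W)"] .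
  have Gk_shear: "Gk k (shear b W) = indicator (cball 0 R') (fst W) * g (s k (fst W)) (snd W)" for k W
    unfolding Gk_def unshear_shear using Q_sum[of k "fst W" "\<lambda>v. g v (snd W)"] .
  have FkL: "L2_fun (Fk k)" for k
    unfolding Fk_def by (intro L2_fun_sum L2_fun_unshear_tensor[OF p FL g_proj Q])
  have Gk_proj: "is_proj (CR_space P) (Fk k) (Gk k)" for k
    unfolding Fk_def Gk_def P_def
    by (intro CP.is_proj_sum[unfolded P_def] L2_fun_unshear_tensor[OF p FL g_proj Q] is_proj_tensor[OF p FL g_proj Q])
  have GkL: "L2_fun (Gk k)" for k
    using Gk_proj[of k] CR_spaceD(1) unfolding is_proj_def by blast
  define G where "G = szego_proj P \<phi>"
  have G_proj: "is_proj (CR_space P) \<phi> G"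
    unfolding G_def P_def by (rule szego_proj_is_proj[OF p L2_fun_test[OF \<phi>]])
  then have GL: "L2_fun G"
    using CR_spaceD(1) unfolding is_proj_def by blast
  note \<phi>L = L2_fun_test[OF \<phi>] and \<psi>L = L2_fun_test[OF \<psi>]

  have cont_slice: "(\<lambda>k. F (s k u) Y) \<longlonglongrightarrow> F u Y" for u Y
  proof -
    have "isCont \<phi> (shear b (u, Y))"
      using test_fun_continuous[OF \<phi>, of UNIV] continuous_on_eq_continuous_at[OF open_UNIV, of \<phi>] by blast
    moreover have "(\<lambda>k. shear b (s k u, Y)) \<longlonglongrightarrow> shear b (u, Y)"
      by (intro bounded_linear.tendsto[OF bounded_linear_shear] tendsto_Pair s tendsto_const)
    ultimately show ?thesis
      unfolding F_def by (rule isCont_tendsto_compose)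
  qed

  have F_lim: "(\<lambda>k. L2_sq (\<lambda>X. Fk k X - \<phi> X)) \<longlonglongrightarrow> 0"
  proof -
    have m: "(\<lambda>X. Fk k X - \<phi> X) \<in> borel_measurable borel" for k
      using L2_fun_measurable[OF L2_fun_diff[OF FkL \<phi>L]] by simp
    have mF: "(\<lambda>W. Fk k (shear b W)) \<in> borel_measurable borel" for k
      using L2_fun_measurable[OF FkL] by (intro measurable_compose[OF measurable_shear]) simp
    have m\<phi>: "(\<lambda>W. \<phi> (shear b W)) \<in> borel_measurable borel"
      using L2_fun_measurable[OF \<phi>L] by (intro measurable_compose[OF measurable_shear]) simp
    have "(\<lambda>k. L2_sq (\<lambda>W. Fk k (shear b W) - \<phi> (shear b W))) \<longlonglongrightarrow> 0"
    proof (rule L2_sq_dominated_convergence)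
      show "(\<lambda>W. Fk k (shear b W)) \<in> borel_measurable lborel" for k
        using mF by simp
      show "(\<lambda>W. \<phi> (shear b W)) \<in> borel_measurable lborel"
        using m\<phi> by simp
      show "cmod (Fk k (shear b W)) \<le> B1 * indicator (cball 0 (R' + R)) W" for k W
      proof (cases "fst W \<in> cball 0 R' \<and> snd W \<in> cball 0 R")
        case True
        then have "norm W \<le> R' + R"
          using norm_Pair_le[of "fst W" "snd W"] by simp
        moreover have "cmod (Fk k (shear b W)) \<le> B1"
          using True F_bound[of "s k (fst W)" "snd W"] by (simp add: Fk_shear)
        ultimately show ?thesis by simp
      next
        case False
        then have "Fk k (shear b W) = 0"
          using F_bound[of "s k (fst W)" "snd W"] by (auto simp: Fk_shear indicator_def)
        then show ?thesis using B1(1) by simp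
      qed
      show "(\<lambda>k. Fk k (shear b W)) \<longlonglongrightarrow> \<phi> (shear b W)" for W
      proof (cases "fst W \<in> cball 0 R'")
        case True
        then show ?thesis
          using cont_slice[of "fst W" "snd W"] by (simp add: Fk_shear F_def)
      next
        case False
        then have "\<phi> (shear b W) = 0"
          using F_out[of "fst W" "snd W"] by (simp add: F_def)
        then show ?thesis using False by (simp add: Fk_shear)
      qed
    qed
    then show ?thesis by (simp add: L2_shear(2)[OF m, where b=b])
  qed
  have G_lim: "(\<lambda>k. L2_sq (\<lambda>X. Gk k X - G X)) \<longlonglongrightarrow> 0"
    by (rule tendsto_sandwich[OF _ _ tendsto_const F_lim])
      (auto intro!: always_eventually CP.is_proj_contraction FkL Gk_proj \<phi>L G_proj)

  have lim1: "(\<lambda>k. \<integral>X. Gk k X * \<psi> X \<partial>lborel) \<longlonglongrightarrow> (\<integral>X. G X * \<psi> X \<partial>lborel)"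
  proof (rule LIM_zero_cancel)
    have le: "norm ((\<integral>X. Gk k X * \<psi> X \<partial>lborel) - (\<integral>X. G X * \<psi> X \<partial>lborel)) 
      \<le> sqrt (L2_sq (\<lambda>X. Gk k X - G X)) * sqrt (L2_sq \<psi>)" for k
      using L2_Cauchy_Schwarz[OF L2_fun_diff[OF GkL GL] \<psi>L, of k]
        L2_mult_integrable[OF GkL \<psi>L, of k] L2_mult_integrable[OF GL \<psi>L]
      by (simp add: left_diff_distrib)
    have lim0: "(\<lambda>k. sqrt (L2_sq (\<lambda>X. Gk k X - G X)) * sqrt (L2_sq \<psi>)) \<longlonglongrightarrow> sqrt 0 * sqrt (L2_sq \<psi>)"
      by (intro tendsto_intros G_lim)
    show "(\<lambda>k. (\<integral>X. Gk k X * \<psi> X \<partial>lborel) - (\<integral>X. G X * \<psi> X \<partial>lborel)) \<longlonglongrightarrow> 0"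
      by (rule Lim_null_comparison[OF always_eventually[OF allI[OF le]]]) (use lim0 in simp)
  qed

  \<comment> \<open>The projected slice and the test slice get separate parameters: the first is
    frozen at v while the second follows u. Measurability is obtained for \<open>c (s k u) u\<close>
    from Fubini, and not for \<open>g u\<close> as a function of u.\<close>
  define c where "c v u = (\<integral>Y. g v Y * \<Psi> u Y \<partial>lborel)" for v u
  have Gk_int: "(\<integral>X. Gk k X * \<psi> X \<partial>lborel) = (\<integral>u. indicator (cball 0 R') u * c (s k u) u \<partial>lborel)"
    and Gk_meas: "(\<lambda>u. indicator (cball 0 R') u * c (s k u) u) \<in> borel_measurable lborel" for k
  proof -
    note i = L2_mult_integrable[OF GkL \<psi>L, of k]
    have m: "(\<lambda>X. Gk k X * \<psi> X) \<in> borel_measurable borel"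
      using borel_measurable_integrable[OF i] by simp
    note i' = i[unfolded integral_shear(2)[OF m, of b]]
    have c: "(\<integral>Y. Gk k (shear b (u, Y)) * \<psi> (shear b (u, Y)) \<partial>lborel) = indicator (cball 0 R') u * c (s k u) u" for u
      by (simp add: Gk_shear c_def \<Psi>_def mult.assoc)
    show "(\<integral>X. Gk k X * \<psi> X \<partial>lborel) = (\<integral>u. indicator (cball 0 R') u * c (s k u) u \<partial>lborel)"
      unfolding integral_shear(1)[OF m, of b] lborel_Fubini(1)[OF i'] c ..
    show "(\<lambda>u. indicator (cball 0 R') u * c (s k u) u) \<in> borel_measurable lborel"
      using borel_measurable_integrable[OF lborel_Fubini(3)[OF i']] unfolding c .
  qed
  define A1 where "A1 = B1\<^sup>2 * measure lborel (cball (0 :: real \<times> real \<times> real) R)"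
  define A2 where "A2 = B2\<^sup>2 * measure lborel (cball (0 :: real \<times> real \<times> real) R)"
  have F_le: "L2_sq (F u) \<le> A1" and \<Psi>_le: "L2_sq (\<Psi> u) \<le> A2" for u
    unfolding A1_def A2_def
    by (intro L2_sq_bound F_bound \<Psi>_bound L2_fun_measurable FL \<Psi>L)+
  have g_le: "L2_sq (g v) \<le> A1" for v
  proof -
    \<comment> \<open>Compared with 0, which is its own projection, contraction becomes a norm
      bound.\<close>
    have "is_proj (CR_space p) (\<lambda>_. 0) (\<lambda>_. 0)"
      by (simp add: is_proj_def Cp.zero L2_inner_def)
    from Cp.is_proj_contraction[OF FL g_proj L2_fun_zero this, of v] F_le[of v]
    show ?thesis by simp
  qed
  have c_le: "cmod (c v u) \<le> sqrt A1 * sqrt A2" for v u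
  proof -
    have "cmod (c v u) \<le> sqrt (L2_sq (g v)) * sqrt (L2_sq (\<Psi> u))"
      unfolding c_def by (rule L2_Cauchy_Schwarz[OF gL \<Psi>L])
    also have "\<dots> \<le> sqrt A1 * sqrt A2"
      using g_le[of v] \<Psi>_le[of u] order_trans[OF L2_sq_nonneg g_le]
      by (intro mult_mono real_sqrt_le_mono) auto
    finally show ?thesis .
  qed
  have c_lim: "(\<lambda>k. c (s k u) u) \<longlonglongrightarrow> c u u" for u
  proof (rule LIM_zero_cancel)
    have Fu_lim: "(\<lambda>k. L2_sq (\<lambda>Y. F (s k u) Y - F u Y)) \<longlonglongrightarrow> 0"
      by (rule L2_sq_dominated_convergence[OF _ _ F_bound cont_slice]) (intro L2_fun_measurable FL)+
    have "(\<lambda>k. L2_sq (\<lambda>Y. g (s k u) Y - g u Y)) \<longlonglongrightarrow> 0"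
      by (rule tendsto_sandwich[OF _ _ tendsto_const Fu_lim])
        (auto intro!: always_eventually Cp.is_proj_contraction FL g_proj)
    then have lim0: "(\<lambda>k. sqrt (L2_sq (\<lambda>Y. g (s k u) Y - g u Y)) * sqrt (L2_sq (\<Psi> u))) \<longlonglongrightarrow> sqrt 0 * sqrt (L2_sq (\<Psi> u))"
      by (intro tendsto_intros)
    have le: "norm (c (s k u) u - c u u) \<le> sqrt (L2_sq (\<lambda>Y. g (s k u) Y - g u Y)) * sqrt (L2_sq (\<Psi> u))" for k
      using L2_Cauchy_Schwarz[OF L2_fun_diff[OF gL gL] \<Psi>L, of "s k u" u u]
        L2_mult_integrable[OF gL \<Psi>L, of _ u]
      by (simp add: left_diff_distrib c_def)
    show "(\<lambda>k. c (s k u) u - c u u) \<longlonglongrightarrow> 0"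
      by (rule Lim_null_comparison[OF always_eventually[OF allI[OF le]]]) (use lim0 in simp)
  qed
  have lim: "(\<lambda>k. indicator (cball 0 R') u * c (s k u) u) \<longlonglongrightarrow> indicator (cball 0 R') u * c u u" for u
    by (intro tendsto_mult tendsto_const c_lim)
  have lim2: "(\<lambda>k. \<integral>X. Gk k X * \<psi> X \<partial>lborel) \<longlonglongrightarrow> (\<integral>u. indicator (cball 0 R') u * c u u \<partial>lborel)"
    unfolding Gk_int
  proof (rule integral_dominated_convergence)
    \<comment> \<open>The diagonal is measurable only as a pointwise limit of the functions with
      frozen first parameter.\<close>
    show "(\<lambda>u. indicator (cball 0 R') u * c u u) \<in> borel_measurable lborel"
      by (rule borel_measurable_LIMSEQ_metric[OF Gk_meas lim])
    show "integrable lborel (\<lambda>u::'u. (sqrt A1 * sqrt A2) * indicator (cball 0 R') u)"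
      by (rule integrable_indicator_cball)
    show "AE u in lborel. norm (indicator (cball 0 R') u * c (s k u) u) \<le> (sqrt A1 * sqrt A2) * indicator (cball 0 R') u" for k
      using c_le by (intro AE_I2) (simp add: indicator_def)
  qed (use Gk_meas lim in auto)
  have drop: "indicator (cball 0 R') u * c u u = c u u" for u
    using \<Psi>_out[of u] by (cases "u \<in> cball 0 R'") (auto simp: c_def)
  show ?thesis
    using LIMSEQ_unique[OF lim1 lim2] unfolding drop
    by (simp add: szego_pair_def G_def P_def c_def g_def F_def[abs_def] \<Psi>_def[abs_def])
qed

text \<open>With u = s - t_n b and u' = s' - t_n' b, the argument of the delta is u - u'. Passing
  from s to u at fixed t_n preserves measure, so pairing the claimed kernel with the product of psi
  and phi leaves a single integral, over the common value of u, of pairings for the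
  one-codimensional kernel.\<close>

theorem theorem1p2:
  fixes p :: "real \<Rightarrow> real" and b :: "real ^ 'm"
    and \<phi> \<psi> :: "real \<times> real \<times> ((real ^ 'm) \<times> real) \<Rightarrow> complex"
  assumes p_smooth: "smooth_fun p"
    and p_growth: "filterlim (\<lambda>x. p x / \<bar>x\<bar>) at_top at_infinity"
    and "test_fun \<phi>" and "test_fun \<psi>"
  shows "szego_pair (\<lambda>x. (p x *\<^sub>R b, p x)) \<phi> \<psi> =
    (\<integral>u. szego_pair p
            (\<lambda>(x', y', \<tau>'). \<phi> (x', y', (u + \<tau>' *\<^sub>R b, \<tau>')))
            (\<lambda>(x, y, \<tau>). \<psi> (x, y, (u + \<tau> *\<^sub>R b, \<tau>))) \<partial>lborel)"
  using szego_pair_slices[OF p_smooth assms(3,4), of b]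
  by (simp add: shear_def case_prod_beta')

end
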